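(* Let $\mathfrak{g}$ be a finite dimensional Lie algebra over $\mathbb{C}$, let $V$ be a right $\mathfrak{g}$-module (equivalently, a right $U(\mathfrak{g})$-module), let $\nabla_{\mathfrak{g}}:V\to\mathfrak{g}\otimes V$ be a locally conilpotent left $\mathfrak{g}$-comodule structure on $V$, and let $\nabla:V\to U(\mathfrak{g})\otimes V$ be the corresponding left $U(\mathfrak{g})$-comodule structure. Then $V$ is a right-left AYD module over $\mathfrak{g}$ if and only if it is a right-left AYD module over $U(\mathfrak{g})$.
   Context: A left $\mathfrak{g}$-comodule is a vector space $V$ with a linear map $\nabla_{\mathfrak{g}}:V\to\mathfrak{g}\otimes V$, $v\mapsto v_{[-1]}\otimes v_{[0]}$ (summation suppressed), with $v_{[-2]}\wedge v_{[-1]}\otimes v_{[0]}=0$, where $v_{[-2]}\otimes v_{[-1]}\otimes v_{[0]}=v_{[-1]}\otimes\nabla_{\mathfrak{g}}(v_{[0]})$. Its iterates are $\nabla^k_{\mathfrak{g}}(v)=v_{[-k]}\otimes\cdots\otimes v_{[-1]}\otimes v_{[0]}\in\mathfrak{g}^{\otimes k}\otimes V$; it is locally conilpotent if for each $v$ some $\nabla^n_{\mathfrak{g}}(v)=0$. The corresponding $U(\mathfrak{g})$-coaction is $$\nabla(v)=1\otimes v+\sum_{k\ge1}\tfrac1{k!}\,v_{[-k]}\cdots v_{[-1]}\otimes v_{[0]}$$ (products taken in $U(\mathfrak{g})$); write $\nabla(v)=v_{\langle-1\rangle}\otimes v_{\langle0\rangle}$. $V$ is right-left AYD (anti-Yetter-Drinfeld)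 over $\mathfrak{g}$ if $\nabla_{\mathfrak{g}}(v\cdot X)=v_{[-1]}\otimes v_{[0]}\cdot X+[v_{[-1]},X]\otimes v_{[0]}$ for all $v\in V$, $X\in\mathfrak{g}$. $V$ is right-left AYD over $U(\mathfrak{g})$ if $\nabla(v\cdot h)=S(h_{(3)})v_{\langle-1\rangle}h_{(1)}\otimes v_{\langle0\rangle}\cdot h_{(2)}$ for all $v\in V$, $h\in U(\mathfrak{g})$, where $S$ is the antipode and $h_{(1)}\otimes h_{(2)}\otimes h_{(3)}$ the iterated coproduct. *)

theory Defs
  imports Complex_Main "HOL-Library.Poly_Mapping"
begin

section \<open>Complex vector spaces and algebras\<close>

class complex_vector = ab_group_add +
  fixes scaleC :: "complex \<Rightarrow> 'a \<Rightarrow> 'a"  (infixr \<open>*\<^sub>C\<close> 75)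
  assumes scaleC_add_right: "c *\<^sub>C (x + y) = c *\<^sub>C x + c *\<^sub>C y"
    and scaleC_add_left: "(c + d) *\<^sub>C x = c *\<^sub>C x + d *\<^sub>C x"
    and scaleC_scaleC: "c *\<^sub>C d *\<^sub>C x = (c * d) *\<^sub>C x"
    and scaleC_one: "1 *\<^sub>C x = x"

global_interpretation complex_vector: vector_space "scaleC :: complex \<Rightarrow> 'a \<Rightarrow> 'a :: complex_vector"
  by unfold_locales
    (simp_all add: scaleC_add_right scaleC_add_left scaleC_scaleC scaleC_one)

global_interpretation complex_vector_pair:
  vector_space_pair "scaleC :: complex \<Rightarrow> 'a \<Rightarrow> 'a :: complex_vector"
    "scaleC :: complex \<Rightarrow> 'b \<Rightarrow> 'b :: complex_vector"
  by unfold_locales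

abbreviation clinear :: "('a::complex_vector \<Rightarrow> 'b::complex_vector) \<Rightarrow> bool"
  where "clinear \<equiv> Vector_Spaces.linear scaleC scaleC"

definition cbilinear :: "('a::complex_vector \<Rightarrow> 'b::complex_vector \<Rightarrow> 'c::complex_vector) \<Rightarrow> bool"
  where "cbilinear f \<longleftrightarrow> (\<forall>x. clinear (f x)) \<and> (\<forall>y. clinear (\<lambda>x. f x y))"

definition finite_dim :: "'a::complex_vector itself \<Rightarrow> bool"
  where "finite_dim _ \<longleftrightarrow> (\<exists>B :: 'a set. finite B \<and> complex_vector.span B = UNIV)"

class complex_algebra_1 = complex_vector + ring_1 +
  assumes scaleC_mult_left: "(c *\<^sub>C x) * y = c *\<^sub>C (x * y)"
    and scaleC_mult_right: "x * (c *\<^sub>C y) = c *\<^sub>C (x * y)"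

class complex_lie_algebra = complex_vector +
  fixes lie_bracket :: "'a \<Rightarrow> 'a \<Rightarrow> 'a"
  assumes lie_bracket_add_left: "lie_bracket (x + y) z = lie_bracket x z + lie_bracket y z"
    and lie_bracket_add_right: "lie_bracket x (y + z) = lie_bracket x y + lie_bracket x z"
    and lie_bracket_scaleC_left: "lie_bracket (c *\<^sub>C x) y = c *\<^sub>C lie_bracket x y"
    and lie_bracket_scaleC_right: "lie_bracket x (c *\<^sub>C y) = c *\<^sub>C lie_bracket x y"
    and lie_bracket_self: "lie_bracket x x = 0"
    and lie_bracket_jacobi:
      "lie_bracket x (lie_bracket y z) + lie_bracket y (lie_bracket z x)
        + lie_bracket z (lie_bracket x y) = 0"

lemma clinear_iff:
  "clinear f \<longleftrightarrow> (\<forall>x y. f (x + y) = f x + f y) \<and> (\<forall>c x. f (c *\<^sub>C x) = c *\<^sub>C f x)"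
  by (simp add: Vector_Spaces.linear_iff complex_vector.vector_space_axioms)

lemma clinearI:
  assumes "\<And>x y. f (x + y) = f x + f y" and "\<And>c x. f (c *\<^sub>C x) = c *\<^sub>C f x"
  shows "clinear f"
  using assms by (simp add: clinear_iff)

lemmas clinear_add = complex_vector_pair.linear_add
  and clinear_diff = complex_vector_pair.linear_diff
  and clinear_scale = complex_vector_pair.linear_scale
  and clinear_0 = complex_vector_pair.linear_0
  and clinear_sum = complex_vector_pair.linear_sum
  and clinear_neg = complex_vector_pair.linear_neg

lemma clinear_compose: "clinear f \<Longrightarrow> clinear g \<Longrightarrow> clinear (\<lambda>x. g (f x))"
  by (simp add: clinear_iff)

lemma clinear_eq_0_on_span:
  assumes "clinear f" "\<And>x. x \<in> R \<Longrightarrow> f x = 0" "x \<in> complex_vector.span R"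
  shows "f x = 0"
  using complex_vector_pair.linear_eq_0_on_span[OF assms(1) _ assms(3)] assms(2) by blast

lemma cbilinearI:
  assumes "\<And>x y z. f (x + y) z = f x z + f y z" "\<And>x y z. f x (y + z) = f x y + f x z"
    "\<And>c x z. f (c *\<^sub>C x) z = c *\<^sub>C f x z" "\<And>c x z. f x (c *\<^sub>C z) = c *\<^sub>C f x z"
  shows "cbilinear f"
  using assms by (simp add: cbilinear_def clinear_iff)

lemma cbilinear_iff:
  "cbilinear f \<longleftrightarrow> (\<forall>x y z. f (x + y) z = f x z + f y z) \<and> (\<forall>x y z. f x (y + z) = f x y + f x z)
    \<and> (\<forall>c x z. f (c *\<^sub>C x) z = c *\<^sub>C f x z) \<and> (\<forall>c x z. f x (c *\<^sub>C z) = c *\<^sub>C f x z)"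
  by (auto simp: cbilinear_def clinear_iff)

lemma exists_clinear_with_value:
  fixes a :: "'a::complex_vector" and e :: "'b::complex_vector"
  assumes "a \<noteq> 0"
  obtains \<phi> :: "'a \<Rightarrow> 'b" where "clinear \<phi>" "\<phi> a = e"
proof -
  have "\<not> complex_vector.dependent {a}"
    using assms by (simp add: complex_vector.dependent_single)
  then obtain \<phi> :: "'a \<Rightarrow> 'b" where "clinear \<phi>" "\<forall>x\<in>{a}. \<phi> x = e"
    using complex_vector_pair.linear_independent_extend[of "{a}" "\<lambda>_. e"] by blast
  then show ?thesis using that by simp
qed

instantiation complex :: complex_algebra_1
begin
definition scaleC_complex :: "complex \<Rightarrow> complex \<Rightarrow> complex" where "scaleC_complex c x = c * x"
instance by standard (simp_all add: scaleC_complex_def algebra_simps)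
end

definition two_sided_ideal :: "'a::complex_algebra_1 set \<Rightarrow> 'a set"
  where "two_sided_ideal R = complex_vector.span {a * r * b |a r b. r \<in> R}"

lemma two_sided_ideal_mult_left:
  assumes "x \<in> two_sided_ideal R" shows "c * x \<in> two_sided_ideal R"
  using assms unfolding two_sided_ideal_def
proof (rule complex_vector.span_induct)
  show "complex_vector.subspace
      {x. c * x \<in> complex_vector.span {a * r * b |a r b. r \<in> R}}"
    by (auto simp: complex_vector.subspace_def distrib_left scaleC_mult_right
        complex_vector.span_zero intro: complex_vector.span_add complex_vector.span_scale)
next
  fix x assume "x \<in> {a * r * b |a r b. r \<in> R}"
  then obtain a r b where "x = a * r * b" "r \<in> R" by blast
  then have "c * x = (c * a) * r * b" by (simp add: mult.assoc)
  with \<open>r \<in> R\<close> show "c * x \<in> complex_vector.span {a * r * b |a r b. r \<in> R}"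
    by (blast intro: complex_vector.span_base)
qed

lemma two_sided_ideal_mult_right:
  assumes "x \<in> two_sided_ideal R" shows "x * c \<in> two_sided_ideal R"
  using assms unfolding two_sided_ideal_def
proof (rule complex_vector.span_induct)
  show "complex_vector.subspace
      {x. x * c \<in> complex_vector.span {a * r * b |a r b. r \<in> R}}"
    by (auto simp: complex_vector.subspace_def distrib_right scaleC_mult_left
        complex_vector.span_zero intro: complex_vector.span_add complex_vector.span_scale)
next
  fix x assume "x \<in> {a * r * b |a r b. r \<in> R}"
  then obtain a r b where "x = a * r * b" "r \<in> R" by blast
  then have "x * c = a * r * (b * c)" by (simp add: mult.assoc)
  with \<open>r \<in> R\<close> show "x * c \<in> complex_vector.span {a * r * b |a r b. r \<in> R}"
    by (blast intro: complex_vector.span_base)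
qed

lemma two_sided_ideal_0: "0 \<in> two_sided_ideal R"
  by (simp add: two_sided_ideal_def complex_vector.span_zero)

lemma two_sided_ideal_add:
  "x \<in> two_sided_ideal R \<Longrightarrow> y \<in> two_sided_ideal R \<Longrightarrow> x + y \<in> two_sided_ideal R"
  by (simp add: two_sided_ideal_def complex_vector.span_add)

lemma two_sided_ideal_neg: "x \<in> two_sided_ideal R \<Longrightarrow> - x \<in> two_sided_ideal R"
  by (simp add: two_sided_ideal_def complex_vector.span_neg)

lemma two_sided_ideal_scale: "x \<in> two_sided_ideal R \<Longrightarrow> c *\<^sub>C x \<in> two_sided_ideal R"
  by (simp add: two_sided_ideal_def complex_vector.span_scale)

lemma two_sided_ideal_base: "r \<in> R \<Longrightarrow> r \<in> two_sided_ideal R"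
  unfolding two_sided_ideal_def
  by (rule complex_vector.span_base, rule CollectI, rule exI[of _ 1], rule exI[of _ r],
      rule exI[of _ 1]) simp


section \<open>Free vector spaces\<close>

instantiation poly_mapping :: (type, complex_vector) complex_vector
begin
lift_definition scaleC_poly_mapping :: "complex \<Rightarrow> ('a \<Rightarrow>\<^sub>0 'b) \<Rightarrow> 'a \<Rightarrow>\<^sub>0 'b"
  is "\<lambda>c f k. c *\<^sub>C f k"
  by (rule finite_subset) (auto simp: complex_vector.scale_zero_right)
instance
  by standard (transfer; simp add: fun_eq_iff scaleC_add_right scaleC_add_left scaleC_scaleC
      scaleC_one)+
end

lemma lookup_scaleC: "Poly_Mapping.lookup (c *\<^sub>C f) k = c *\<^sub>C Poly_Mapping.lookup f k"
  by (simp add: scaleC_poly_mapping.rep_eq)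

lemma scaleC_single: "c *\<^sub>C Poly_Mapping.single k a = Poly_Mapping.single k (c *\<^sub>C a)"
  by (rule poly_mapping_eqI) (simp add: lookup_scaleC lookup_single when_def)

lemma poly_mapping_single_induct [case_names single add]:
  assumes single: "\<And>k a. P (Poly_Mapping.single k a)"
    and add: "\<And>f g. P f \<Longrightarrow> P g \<Longrightarrow> P (f + g)"
  shows "P f"
proof (induction f rule: update_induct)
  case const
  show ?case using single[of undefined 0] by simp
next
  case (update f k b)
  have "Poly_Mapping.update k b f = f + Poly_Mapping.single k b"
    using update(1)
    by (intro poly_mapping_eqI) (auto simp: lookup_update lookup_add lookup_single in_keys_iff when_def)
  then show ?case using add[OF update(3) single] by simp
qed

instance poly_mapping :: (monoid_add, complex_algebra_1) complex_algebra_1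
proof
  fix c and x y :: "'a \<Rightarrow>\<^sub>0 'b"
  show "(c *\<^sub>C x) * y = c *\<^sub>C (x * y)"
  proof (induction x rule: poly_mapping_single_induct)
    case (single k a)
    show ?case
      by (induction y rule: poly_mapping_single_induct)
        (simp_all add: scaleC_single mult_single scaleC_mult_left distrib_left scaleC_add_right)
  qed (simp add: scaleC_add_right distrib_right)
  show "x * (c *\<^sub>C y) = c *\<^sub>C (x * y)"
  proof (induction x rule: poly_mapping_single_induct)
    case (single k a)
    show ?case
      by (induction y rule: poly_mapping_single_induct)
        (simp_all add: scaleC_single mult_single scaleC_mult_right distrib_left scaleC_add_right)
  qed (simp add: scaleC_add_right distrib_right)
qed

definition lin_ext :: "('k \<Rightarrow> 'b::complex_vector) \<Rightarrow> ('k \<Rightarrow>\<^sub>0 complex) \<Rightarrow> 'b"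
  where "lin_ext f p = (\<Sum>k\<in>Poly_Mapping.keys p. Poly_Mapping.lookup p k *\<^sub>C f k)"

lemma lin_ext_superset:
  assumes "finite A" "Poly_Mapping.keys p \<subseteq> A"
  shows "lin_ext f p = (\<Sum>k\<in>A. Poly_Mapping.lookup p k *\<^sub>C f k)"
  unfolding lin_ext_def using assms
  by (intro sum.mono_neutral_left) (auto simp: in_keys_iff)

lemma lin_ext_single: "lin_ext f (Poly_Mapping.single k a) = a *\<^sub>C f k"
  by (subst lin_ext_superset[of "{k}"]) auto

lemma clinear_lin_ext: "clinear (lin_ext f)"
proof (rule clinearI)
  fix x y :: "'a \<Rightarrow>\<^sub>0 complex" and c
  let ?A = "Poly_Mapping.keys x \<union> Poly_Mapping.keys y"
  have "lin_ext f (x + y) = (\<Sum>k\<in>?A. Poly_Mapping.lookup (x + y) k *\<^sub>C f k)"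
    using Poly_Mapping.keys_add[of x y] by (intro lin_ext_superset) auto
  also have "\<dots> = (\<Sum>k\<in>?A. Poly_Mapping.lookup x k *\<^sub>C f k) + (\<Sum>k\<in>?A. Poly_Mapping.lookup y k *\<^sub>C f k)"
    by (simp add: lookup_add scaleC_add_left sum.distrib)
  also have "\<dots> = lin_ext f x + lin_ext f y"
    by (simp add: lin_ext_superset[of ?A])
  finally show "lin_ext f (x + y) = lin_ext f x + lin_ext f y" .
  have "lin_ext f (c *\<^sub>C x) = (\<Sum>k\<in>Poly_Mapping.keys x. Poly_Mapping.lookup (c *\<^sub>C x) k *\<^sub>C f k)"
    by (intro lin_ext_superset) (auto simp: in_keys_iff lookup_scaleC scaleC_complex_def)
  then show "lin_ext f (c *\<^sub>C x) = c *\<^sub>C lin_ext f x"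
    by (simp add: lin_ext_def lookup_scaleC scaleC_complex_def complex_vector.scale_sum_right
        scaleC_scaleC)
qed

lemmas lin_ext_add = clinear_add[OF clinear_lin_ext]
  and lin_ext_diff = clinear_diff[OF clinear_lin_ext]
  and lin_ext_scale = clinear_scale[OF clinear_lin_ext]


section \<open>Tensor products\<close>

definition tensor_relators :: "('a::complex_vector \<times> 'b::complex_vector \<Rightarrow>\<^sub>0 complex) set"
  where "tensor_relators =
    {Poly_Mapping.single (a + a', b) 1 - Poly_Mapping.single (a, b) 1 - Poly_Mapping.single (a', b) 1
      |a a' b. True} \<union>
    {Poly_Mapping.single (a, b + b') 1 - Poly_Mapping.single (a, b) 1 - Poly_Mapping.single (a, b') 1
      |a b b'. True} \<union>
    {Poly_Mapping.single (c *\<^sub>C a, b) 1 - c *\<^sub>C Poly_Mapping.single (a, b) 1 |c a b. True} \<union>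
    {Poly_Mapping.single (a, c *\<^sub>C b) 1 - c *\<^sub>C Poly_Mapping.single (a, b) 1 |c a b. True}"

lemma diff_span_sym:
  assumes "x - y \<in> complex_vector.span R" shows "y - x \<in> complex_vector.span R"
proof -
  have "y - x = - (x - y)" by simp
  then show ?thesis using complex_vector.span_neg[OF assms] by simp
qed

lemma diff_span_add:
  assumes "x - x' \<in> complex_vector.span R" "y - y' \<in> complex_vector.span R"
  shows "(x + y) - (x' + y') \<in> complex_vector.span R"
proof -
  have "(x + y) - (x' + y') = (x - x') + (y - y')" by simp
  then show ?thesis using complex_vector.span_add[OF assms] by (simp only:)
qed

lemma diff_span_neg:
  assumes "x - x' \<in> complex_vector.span R"
  shows "- x - - x' \<in> complex_vector.span R"
proof -
  have "- x - - x' = - (x - x')" by simp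
  then show ?thesis using complex_vector.span_neg[OF assms] by simp
qed

lemma diff_span_diff:
  assumes "x - x' \<in> complex_vector.span R" "y - y' \<in> complex_vector.span R"
  shows "(x - y) - (x' - y') \<in> complex_vector.span R"
proof -
  have "(x - y) - (x' - y') = (x - x') - (y - y')" by simp
  then show ?thesis using complex_vector.span_diff[OF assms] by (simp only:)
qed

lemma diff_span_scale:
  assumes "x - x' \<in> complex_vector.span R"
  shows "c *\<^sub>C x - c *\<^sub>C x' \<in> complex_vector.span R"
  using complex_vector.span_scale[OF assms, of c]
  by (simp add: complex_vector.scale_right_diff_distrib)

lemma equivp_diff_span: "equivp (\<lambda>x y. x - y \<in> complex_vector.span R)"
proof (rule equivpI)
  show "reflp (\<lambda>x y. x - y \<in> complex_vector.span R)"
    by (rule reflpI) (simp add: complex_vector.span_zero)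
  show "symp (\<lambda>x y. x - y \<in> complex_vector.span R)"
    by (rule sympI) (rule diff_span_sym)
  show "transp (\<lambda>x y. x - y \<in> complex_vector.span R)"
  proof (rule transpI)
    fix x y z assume "x - y \<in> complex_vector.span R" "y - z \<in> complex_vector.span R"
    from complex_vector.span_add[OF this] show "x - z \<in> complex_vector.span R" by simp
  qed
qed

quotient_type (overloaded) ('a, 'b) tensor =
  "'a::complex_vector \<times> 'b::complex_vector \<Rightarrow>\<^sub>0 complex" /
  "\<lambda>x y. x - y \<in> complex_vector.span tensor_relators"
  by (rule equivp_diff_span)

instantiation tensor :: (complex_vector, complex_vector) complex_vector
begin
lift_definition zero_tensor :: "('a, 'b) tensor" is 0 .
lift_definition plus_tensor :: "('a, 'b) tensor \<Rightarrow> ('a, 'b) tensor \<Rightarrow> ('a, 'b) tensor" is "(+)"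
  by (rule diff_span_add)
lift_definition uminus_tensor :: "('a, 'b) tensor \<Rightarrow> ('a, 'b) tensor" is uminus
  by (rule diff_span_neg)
lift_definition minus_tensor :: "('a, 'b) tensor \<Rightarrow> ('a, 'b) tensor \<Rightarrow> ('a, 'b) tensor" is "(-)"
  by (rule diff_span_diff)
lift_definition scaleC_tensor :: "complex \<Rightarrow> ('a, 'b) tensor \<Rightarrow> ('a, 'b) tensor" is scaleC
  by (rule diff_span_scale)
instance
  by standard
    (transfer; simp add: complex_vector.span_zero add.assoc scaleC_add_right scaleC_add_left
      scaleC_scaleC scaleC_one)+
end

lift_definition tensor :: "'a::complex_vector \<Rightarrow> 'b::complex_vector \<Rightarrow> ('a, 'b) tensor"
    (infixr \<open>\<otimes>\<close> 70)
  is "\<lambda>a b. Poly_Mapping.single (a, b) 1" .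

lemma tensor_rep_exhaust: obtains p where "t = abs_tensor p"
  by (rule that[of "rep_tensor t"]) (rule Quotient3_abs_rep[OF Quotient3_tensor, symmetric])

lemma tensor_add_left: "(a + a') \<otimes> b = a \<otimes> b + a' \<otimes> b"
proof transfer
  fix a a' :: 'a and b :: 'b
  have "Poly_Mapping.single (a + a', b) 1 - Poly_Mapping.single (a, b) 1
      - Poly_Mapping.single (a', b) 1 \<in> complex_vector.span tensor_relators"
    by (rule complex_vector.span_base) (unfold tensor_relators_def, blast)
  then show "Poly_Mapping.single (a + a', b) 1 - (Poly_Mapping.single (a, b) 1
      + Poly_Mapping.single (a', b) 1) \<in> complex_vector.span tensor_relators"
    by (simp only: diff_diff_eq)
qed

lemma tensor_add_right: "a \<otimes> (b + b') = a \<otimes> b + a \<otimes> b'"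
proof transfer
  fix a :: 'a and b b' :: 'b
  have "Poly_Mapping.single (a, b + b') 1 - Poly_Mapping.single (a, b) 1
      - Poly_Mapping.single (a, b') 1 \<in> complex_vector.span tensor_relators"
    by (rule complex_vector.span_base) (unfold tensor_relators_def, blast)
  then show "Poly_Mapping.single (a, b + b') 1 - (Poly_Mapping.single (a, b) 1
      + Poly_Mapping.single (a, b') 1) \<in> complex_vector.span tensor_relators"
    by (simp only: diff_diff_eq)
qed

lemma tensor_scale_left: "(c *\<^sub>C a) \<otimes> b = c *\<^sub>C (a \<otimes> b)"
  by transfer (rule complex_vector.span_base, unfold tensor_relators_def, blast)

lemma tensor_scale_right: "a \<otimes> (c *\<^sub>C b) = c *\<^sub>C (a \<otimes> b)"
  by transfer (rule complex_vector.span_base, unfold tensor_relators_def, blast)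

lemma cbilinear_tensor: "cbilinear (\<otimes>)"
  by (rule cbilinearI) (rule tensor_add_left tensor_add_right tensor_scale_left tensor_scale_right)+

lemma tensor_induct [case_names tensor add]:
  assumes tensor: "\<And>a b. P (a \<otimes> b)" and add: "\<And>s t. P s \<Longrightarrow> P t \<Longrightarrow> P (s + t)"
  shows "P t"
proof -
  have "P (abs_tensor p)" for p
  proof (induction p rule: poly_mapping_single_induct)
    case (single k c)
    obtain a b where k: "k = (a, b)" by force
    have "Poly_Mapping.single k c = c *\<^sub>C Poly_Mapping.single (a, b) 1"
      by (simp add: scaleC_single k scaleC_complex_def)
    then have "abs_tensor (Poly_Mapping.single k c) = c *\<^sub>C (a \<otimes> b)"
      by (simp add: scaleC_tensor.abs_eq tensor.abs_eq)
    also have "\<dots> = (c *\<^sub>C a) \<otimes> b"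
      by (simp add: tensor_scale_left)
    finally show ?case using tensor by simp
  next
    case (add f g)
    then show ?case
      using assms(2)[of "abs_tensor f" "abs_tensor g"] by (simp add: plus_tensor.abs_eq)
  qed
  then show ?thesis by (metis tensor_rep_exhaust)
qed

text \<open>For bilinear \<open>f\<close>, \<open>tensor_lift f\<close> is the linear map with
  \<open>a \<otimes> b \<mapsto> f a b\<close>; only then is its value independent of the chosen representative.\<close>

definition tensor_lift ::
    "('a::complex_vector \<Rightarrow> 'b::complex_vector \<Rightarrow> 'c::complex_vector) \<Rightarrow> ('a, 'b) tensor \<Rightarrow> 'c"
  where "tensor_lift f t = lin_ext (\<lambda>(a, b). f a b) (rep_tensor t)"

lemma tensor_lift_abs:
  assumes "cbilinear f"
  shows "tensor_lift f (abs_tensor p) = lin_ext (\<lambda>(a, b). f a b) p"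
proof -
  let ?F = "lin_ext (\<lambda>(a, b). f a b)"
  have "abs_tensor (rep_tensor (abs_tensor p)) = abs_tensor p"
    by (rule Quotient3_abs_rep[OF Quotient3_tensor])
  then have "rep_tensor (abs_tensor p) - p \<in> complex_vector.span tensor_relators"
    by (simp only: tensor.abs_eq_iff)
  then have "?F (rep_tensor (abs_tensor p) - p) = 0"
  proof (rule clinear_eq_0_on_span[OF clinear_lin_ext, rotated])
    fix x :: "'a \<times> 'b \<Rightarrow>\<^sub>0 complex"
    assume "x \<in> tensor_relators"
    then show "?F x = 0" using assms
      by (auto simp: tensor_relators_def lin_ext_diff lin_ext_scale lin_ext_single cbilinear_iff
          scaleC_one)
  qed
  then show ?thesis by (simp add: tensor_lift_def lin_ext_diff)
qed

lemma tensor_lift_tensor: "cbilinear f \<Longrightarrow> tensor_lift f (a \<otimes> b) = f a b"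
  by (simp add: tensor.abs_eq tensor_lift_abs lin_ext_single scaleC_one)

lemma clinear_tensor_lift:
  fixes f :: "'a::complex_vector \<Rightarrow> 'b::complex_vector \<Rightarrow> 'c::complex_vector"
  assumes "cbilinear f" shows "clinear (tensor_lift f)"
proof (rule clinearI)
  fix s t :: "('a, 'b) tensor" and c
  obtain p q where s: "s = abs_tensor p" and t: "t = abs_tensor q"
    by (metis tensor_rep_exhaust)
  show "tensor_lift f (s + t) = tensor_lift f s + tensor_lift f t"
    by (simp add: s t plus_tensor.abs_eq tensor_lift_abs[OF assms] lin_ext_add)
  show "tensor_lift f (c *\<^sub>C s) = c *\<^sub>C tensor_lift f s"
    by (simp add: s scaleC_tensor.abs_eq tensor_lift_abs[OF assms] lin_ext_scale)
qed

lemma tensor_lift_fun_add: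
  "tensor_lift (\<lambda>a b. f a b + g a b) t = tensor_lift f t + tensor_lift g t"
  by (simp add: tensor_lift_def lin_ext_def case_prod_unfold scaleC_add_right sum.distrib)

lemma tensor_lift_fun_scale: "tensor_lift (\<lambda>a b. c *\<^sub>C f a b) t = c *\<^sub>C tensor_lift f t"
  by (simp add: tensor_lift_def lin_ext_def case_prod_unfold complex_vector.scale_sum_right
      scaleC_scaleC mult.commute)

definition tensor_map ::
    "('a::complex_vector \<Rightarrow> 'c::complex_vector) \<Rightarrow> ('b::complex_vector \<Rightarrow> 'd::complex_vector)
      \<Rightarrow> ('a, 'b) tensor \<Rightarrow> ('c, 'd) tensor"
  where "tensor_map f g = tensor_lift (\<lambda>a b. f a \<otimes> g b)"

lemma cbilinear_tensor_comp: "clinear f \<Longrightarrow> clinear g \<Longrightarrow> cbilinear (\<lambda>a b. f a \<otimes> g b)"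
  by (simp add: cbilinear_iff clinear_iff tensor_add_left tensor_add_right tensor_scale_left
      tensor_scale_right)

lemma tensor_map_tensor:
  "clinear f \<Longrightarrow> clinear g \<Longrightarrow> tensor_map f g (a \<otimes> b) = f a \<otimes> g b"
  by (simp add: tensor_map_def tensor_lift_tensor cbilinear_tensor_comp)

lemma clinear_tensor_map: "clinear f \<Longrightarrow> clinear g \<Longrightarrow> clinear (tensor_map f g)"
  by (simp add: tensor_map_def clinear_tensor_lift cbilinear_tensor_comp)

instantiation tensor :: (complex_algebra_1, complex_algebra_1) complex_algebra_1
begin

definition one_tensor :: "('a, 'b) tensor" where "1 = 1 \<otimes> 1"

definition times_tensor :: "('a, 'b) tensor \<Rightarrow> ('a, 'b) tensor \<Rightarrow> ('a, 'b) tensor"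
  where "s * t = tensor_lift (\<lambda>a b. tensor_lift (\<lambda>c d. (a * c) \<otimes> (b * d)) t) s"

instance
proof
  have bil: "cbilinear (\<lambda>c d. (a * c) \<otimes> (b * d))" for a :: 'a and b :: 'b
    by (simp add: cbilinear_iff tensor_add_left tensor_add_right tensor_scale_left
        tensor_scale_right distrib_left scaleC_mult_right)
  have bil2: "cbilinear (\<lambda>a b. tensor_lift (\<lambda>c d. (a * c) \<otimes> (b * d)) t)"
    for t :: "('a, 'b) tensor"
    by (simp add: cbilinear_iff tensor_add_left tensor_add_right tensor_scale_left
        tensor_scale_right distrib_right scaleC_mult_left tensor_lift_fun_add tensor_lift_fun_scale)
  fix s t u :: "('a, 'b) tensor" and c :: complex
  show distr: "(s + t) * u = s * u + t * u" for s t u :: "('a, 'b) tensor"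
    unfolding times_tensor_def by (rule clinear_add[OF clinear_tensor_lift[OF bil2]])
  show scl: "(c *\<^sub>C s) * t = c *\<^sub>C (s * t)" for c and s t :: "('a, 'b) tensor"
    unfolding times_tensor_def by (rule clinear_scale[OF clinear_tensor_lift[OF bil2]])
  have pure: "(a \<otimes> b) * t = tensor_lift (\<lambda>c d. (a * c) \<otimes> (b * d)) t"
    for a b and t :: "('a, 'b) tensor"
    unfolding times_tensor_def by (rule tensor_lift_tensor[OF bil2])
  have pure2: "(a \<otimes> b) * (c \<otimes> d) = (a * c) \<otimes> (b * d)" for a c :: 'a and b d :: 'b
    by (simp add: pure tensor_lift_tensor[OF bil])
  show distl: "s * (t + u) = s * t + s * u" for s t u :: "('a, 'b) tensor"
    by (induction s rule: tensor_induct)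
      (simp_all add: pure clinear_add[OF clinear_tensor_lift[OF bil]] distr)
  show "s * (c *\<^sub>C t) = c *\<^sub>C (s * t)"
    by (induction s rule: tensor_induct)
      (simp_all add: pure clinear_scale[OF clinear_tensor_lift[OF bil]] distr scaleC_add_right)
  show "(s * t) * u = s * (t * u)"
  proof (induction s rule: tensor_induct)
    case s: (tensor a b)
    show ?case
    proof (induction t rule: tensor_induct)
      case t: (tensor c d)
      show ?case
        by (induction u rule: tensor_induct) (simp_all add: pure2 mult.assoc distl)
    qed (simp add: distl distr)
  qed (simp add: distr)
  show "1 * s = s"
    by (induction s rule: tensor_induct) (simp_all add: pure2 one_tensor_def distl)
  show "s * 1 = s"
    by (induction s rule: tensor_induct) (simp_all add: pure2 one_tensor_def distr)
  show "(0 :: ('a, 'b) tensor) \<noteq> 1"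
  proof
    assume eq: "(0 :: ('a, 'b) tensor) = 1"
    obtain \<phi> :: "'a \<Rightarrow> complex" where \<phi>: "clinear \<phi>" "\<phi> 1 = 1"
      by (rule exists_clinear_with_value[of 1 1]) auto
    obtain \<psi> :: "'b \<Rightarrow> complex" where \<psi>: "clinear \<psi>" "\<psi> 1 = 1"
      by (rule exists_clinear_with_value[of 1 1]) auto
    have bl: "cbilinear (\<lambda>a b. \<phi> a * \<psi> b)"
      using \<phi>(1) \<psi>(1) by (simp add: cbilinear_iff clinear_iff scaleC_complex_def algebra_simps)
    have "tensor_lift (\<lambda>a b. \<phi> a * \<psi> b) (1 \<otimes> 1) = 1"
      by (simp add: tensor_lift_tensor[OF bl] \<phi> \<psi>)
    moreover have "tensor_lift (\<lambda>a b. \<phi> a * \<psi> b) 0 = 0"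
      by (rule clinear_0[OF clinear_tensor_lift[OF bl]])
    ultimately show False using eq by (simp add: one_tensor_def)
  qed
qed

end

lemma tensor_times_tensor:
  fixes a c :: "'a::complex_algebra_1" and b d :: "'b::complex_algebra_1"
  shows "(a \<otimes> b) * (c \<otimes> d) = (a * c) \<otimes> (b * d)"
proof -
  have 1: "cbilinear (\<lambda>a b. tensor_lift (\<lambda>c d. (a * c) \<otimes> (b * d)) t)"
    for t :: "('a, 'b) tensor"
    by (simp add: cbilinear_iff tensor_add_left tensor_add_right tensor_scale_left
        tensor_scale_right distrib_right scaleC_mult_left tensor_lift_fun_add tensor_lift_fun_scale)
  have 2: "cbilinear (\<lambda>c d. (a * c) \<otimes> (b * d))"
    by (simp add: cbilinear_iff tensor_add_left tensor_add_right tensor_scale_left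
        tensor_scale_right distrib_left scaleC_mult_right)
  show ?thesis
    by (simp add: times_tensor_def tensor_lift_tensor[OF 1] tensor_lift_tensor[OF 2])
qed


section \<open>The exterior square\<close>

quotient_type (overloaded) 'a ext2 = "('a::complex_vector, 'a) tensor" /
  "\<lambda>x y. x - y \<in> complex_vector.span {X \<otimes> X |X. True}"
  by (rule equivp_diff_span)

instantiation ext2 :: (complex_vector) complex_vector
begin
lift_definition zero_ext2 :: "'a ext2" is 0 .
lift_definition plus_ext2 :: "'a ext2 \<Rightarrow> 'a ext2 \<Rightarrow> 'a ext2" is "(+)"
  by (rule diff_span_add)
lift_definition uminus_ext2 :: "'a ext2 \<Rightarrow> 'a ext2" is uminus
  by (rule diff_span_neg)
lift_definition minus_ext2 :: "'a ext2 \<Rightarrow> 'a ext2 \<Rightarrow> 'a ext2" is "(-)"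
  by (rule diff_span_diff)
lift_definition scaleC_ext2 :: "complex \<Rightarrow> 'a ext2 \<Rightarrow> 'a ext2" is scaleC
  by (rule diff_span_scale)
instance
  by standard
    (transfer; simp add: complex_vector.span_zero add.assoc scaleC_add_right scaleC_add_left
      scaleC_scaleC scaleC_one)+
end

lift_definition wedge :: "'a::complex_vector \<Rightarrow> 'a \<Rightarrow> 'a ext2"  (infixr \<open>\<and>\<^sub>2\<close> 70)
  is "\<lambda>X Y. X \<otimes> Y" .

lemma wedge_self: "X \<and>\<^sub>2 X = 0"
  by transfer (rule complex_vector.span_base, auto)

lemma cbilinear_wedge: "cbilinear (\<and>\<^sub>2)"
  by (rule cbilinearI)
    (transfer; simp add: tensor_add_left tensor_add_right tensor_scale_left tensor_scale_right
      complex_vector.span_zero)+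


section \<open>The tensor algebra\<close>

datatype 'a free_word = FreeWord (letters: "'a list")

instantiation free_word :: (type) monoid_add
begin
definition zero_free_word :: "'a free_word" where "0 = FreeWord []"
definition plus_free_word :: "'a free_word \<Rightarrow> 'a free_word \<Rightarrow> 'a free_word"
  where "u + w = FreeWord (letters u @ letters w)"
instance by standard (auto simp: zero_free_word_def plus_free_word_def free_word.expand)
end

definition free_gen :: "'a \<Rightarrow> 'a free_word \<Rightarrow>\<^sub>0 complex"
  where "free_gen X = Poly_Mapping.single (FreeWord [X]) 1"

text \<open>\<open>T(V)\<close> is the free algebra on the set \<open>V\<close> modulo the relations making
  \<open>X \<mapsto> [X]\<close> linear. The ideal is spanned by the multilinearity relations among words of a
  fixed length, so the words of length \<open>k\<close> span a direct summand \<open>V\<^sup>\<otimes>\<^sup>k\<close>.\<close>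

definition ta_relators :: "('a::complex_vector free_word \<Rightarrow>\<^sub>0 complex) set"
  where "ta_relators =
    {free_gen (X + Y) - free_gen X - free_gen Y |X Y. True} \<union>
    {free_gen (c *\<^sub>C X) - c *\<^sub>C free_gen X |c X. True}"

quotient_type (overloaded) 'a ta = "'a::complex_vector free_word \<Rightarrow>\<^sub>0 complex" /
  "\<lambda>x y. x - y \<in> two_sided_ideal ta_relators"
  unfolding two_sided_ideal_def by (rule equivp_diff_span)

instantiation ta :: (complex_vector) complex_vector
begin
lift_definition zero_ta :: "'a ta" is 0 .
lift_definition plus_ta :: "'a ta \<Rightarrow> 'a ta \<Rightarrow> 'a ta" is "(+)"
  unfolding two_sided_ideal_def by (rule diff_span_add)
lift_definition uminus_ta :: "'a ta \<Rightarrow> 'a ta" is uminus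
  unfolding two_sided_ideal_def by (rule diff_span_neg)
lift_definition minus_ta :: "'a ta \<Rightarrow> 'a ta \<Rightarrow> 'a ta" is "(-)"
  unfolding two_sided_ideal_def by (rule diff_span_diff)
lift_definition scaleC_ta :: "complex \<Rightarrow> 'a ta \<Rightarrow> 'a ta" is scaleC
  unfolding two_sided_ideal_def by (rule diff_span_scale)
instance
  by standard
    (transfer; simp add: two_sided_ideal_0 add.assoc scaleC_add_right scaleC_add_left
      scaleC_scaleC scaleC_one)+
end

lemma ta_rep_exhaust: obtains p where "t = abs_ta p"
  by (rule that[of "rep_ta t"]) (rule Quotient3_abs_rep[OF Quotient3_ta, symmetric])

definition word_multilinear :: "('a::complex_vector list \<Rightarrow> 'b::complex_vector) \<Rightarrow> bool"
  where "word_multilinear f \<longleftrightarrow> (\<forall>u w. clinear (\<lambda>X. f (u @ [X] @ w)))"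

text \<open>For multilinear \<open>f\<close>, \<open>ta_ext f\<close> is the linear map with
  \<open>X\<^sub>1 \<cdots> X\<^sub>n \<mapsto> f [X\<^sub>1, \<dots>, X\<^sub>n]\<close>.\<close>

definition ta_ext :: "('a::complex_vector list \<Rightarrow> 'b::complex_vector) \<Rightarrow> 'a ta \<Rightarrow> 'b"
  where "ta_ext f t = lin_ext (\<lambda>w. f (letters w)) (rep_ta t)"

lemma lin_ext_ta_ideal:
  fixes f :: "'a::complex_vector list \<Rightarrow> 'b::complex_vector"
  assumes f: "word_multilinear f" and x: "x \<in> two_sided_ideal ta_relators"
  shows "lin_ext (\<lambda>w. f (letters w)) x = 0"
  using x unfolding two_sided_ideal_def
proof (rule clinear_eq_0_on_span[OF clinear_lin_ext, rotated])
  let ?F = "lin_ext (\<lambda>w. f (letters w))"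
  have word: "?F (Poly_Mapping.single k \<alpha> * free_gen X * Poly_Mapping.single l \<beta>)
      = (\<alpha> * \<beta>) *\<^sub>C f (letters k @ [X] @ letters l)" for k \<alpha> X l \<beta>
    by (simp add: free_gen_def mult_single lin_ext_single plus_free_word_def)
  have lin: "clinear (\<lambda>X. f (u @ [X] @ w))" for u w
    using f by (simp add: word_multilinear_def)
  fix x :: "'a free_word \<Rightarrow>\<^sub>0 complex"
  assume "x \<in> {a * r * b |a r b. r \<in> ta_relators}"
  then obtain a r b where x: "x = a * r * b" and r: "r \<in> ta_relators" by blast
  have "?F (a * r * b) = 0"
  proof (induction a rule: poly_mapping_single_induct)
    case a: (single k \<alpha>)
    show ?case
    proof (induction b rule: poly_mapping_single_induct)
      case b: (single l \<beta>)
      let ?u = "letters k" and ?w = "letters l"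
      from r consider X Y where "r = free_gen (X + Y) - free_gen X - free_gen Y"
        | c X where "r = free_gen (c *\<^sub>C X) - c *\<^sub>C free_gen X"
        unfolding ta_relators_def by blast
      then show ?case
      proof cases
        case 1
        then show ?thesis
          by (simp only: right_diff_distrib left_diff_distrib lin_ext_diff word
              clinear_add[OF lin, of ?u] scaleC_add_right)
            simp
      next
        case 2
        then show ?thesis
          by (simp only: right_diff_distrib left_diff_distrib lin_ext_diff word scaleC_mult_left
              scaleC_mult_right lin_ext_scale clinear_scale[OF lin, of ?u])
            (simp add: scaleC_scaleC mult.commute)
      qed
    qed (simp add: distrib_left lin_ext_add)
  qed (simp add: distrib_right lin_ext_add)
  then show "?F x = 0" by (simp add: x)
qed

lemma ta_ext_abs:
  assumes "word_multilinear f"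
  shows "ta_ext f (abs_ta p) = lin_ext (\<lambda>w. f (letters w)) p"
proof -
  have "abs_ta (rep_ta (abs_ta p)) = abs_ta p"
    by (rule Quotient3_abs_rep[OF Quotient3_ta])
  then have "rep_ta (abs_ta p) - p \<in> two_sided_ideal ta_relators"
    by (simp only: ta.abs_eq_iff)
  then show ?thesis
    using lin_ext_ta_ideal[OF assms] by (fastforce simp: ta_ext_def lin_ext_diff)
qed

lemma clinear_ta_ext:
  fixes f :: "'a::complex_vector list \<Rightarrow> 'b::complex_vector"
  assumes "word_multilinear f" shows "clinear (ta_ext f)"
proof (rule clinearI)
  fix s t :: "'a ta" and c
  obtain p q where s: "s = abs_ta p" and t: "t = abs_ta q"
    by (metis ta_rep_exhaust)
  show "ta_ext f (s + t) = ta_ext f s + ta_ext f t"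
    by (simp add: s t plus_ta.abs_eq ta_ext_abs[OF assms] lin_ext_add)
  show "ta_ext f (c *\<^sub>C s) = c *\<^sub>C ta_ext f s"
    by (simp add: s scaleC_ta.abs_eq ta_ext_abs[OF assms] lin_ext_scale)
qed

instantiation ta :: (complex_vector) complex_algebra_1
begin
lift_definition one_ta :: "'a ta" is 1 .
lift_definition times_ta :: "'a ta \<Rightarrow> 'a ta \<Rightarrow> 'a ta" is "(*)"
proof -
  fix x x' y y' :: "'a free_word \<Rightarrow>\<^sub>0 complex"
  assume "x - x' \<in> two_sided_ideal ta_relators" "y - y' \<in> two_sided_ideal ta_relators"
  then have "(x - x') * y + x' * (y - y') \<in> two_sided_ideal ta_relators"
    by (intro two_sided_ideal_add two_sided_ideal_mult_left two_sided_ideal_mult_right)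
  moreover have "(x - x') * y + x' * (y - y') = x * y - x' * y'"
    by (simp add: algebra_simps)
  ultimately show "x * y - x' * y' \<in> two_sided_ideal ta_relators" by simp
qed
instance
proof
  show "(0 :: 'a ta) \<noteq> 1"
  proof
    let ?f = "\<lambda>ws :: 'a list. if ws = [] then 1 else 0 :: complex"
    assume eq: "(0 :: 'a ta) = 1"
    have f: "word_multilinear ?f"
      by (simp add: word_multilinear_def clinear_iff)
    have "ta_ext ?f (abs_ta 1) = 1"
      unfolding ta_ext_abs[OF f] single_one[symmetric] lin_ext_single
      by (simp add: zero_free_word_def scaleC_complex_def)
    then show False
      using eq clinear_0[OF clinear_ta_ext[OF f]] by (simp add: one_ta.abs_eq)
  qed
qed (transfer; simp add: two_sided_ideal_0 algebra_simps scaleC_mult_left scaleC_mult_right)+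
end

lift_definition ta_gen :: "'a::complex_vector \<Rightarrow> 'a ta" is free_gen .

lemma clinear_ta_gen: "clinear ta_gen"
proof (rule clinearI; transfer)
  fix X Y :: 'a and c
  have "free_gen (X + Y) - free_gen X - free_gen Y \<in> two_sided_ideal ta_relators"
    by (rule two_sided_ideal_base) (auto simp: ta_relators_def)
  then show "free_gen (X + Y) - (free_gen X + free_gen Y) \<in> two_sided_ideal ta_relators"
    by (simp only: diff_diff_eq)
  show "free_gen (c *\<^sub>C X) - c *\<^sub>C free_gen X \<in> two_sided_ideal ta_relators"
    by (rule two_sided_ideal_base) (auto simp: ta_relators_def)
qed

lemma prod_list_ta_gen: "prod_list (map ta_gen ws) = abs_ta (Poly_Mapping.single (FreeWord ws) 1)"
proof (induction ws)
  case Nil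
  show ?case by (simp add: one_ta.abs_eq zero_free_word_def[symmetric])
next
  case (Cons X ws)
  then show ?case
    by (simp add: ta_gen.abs_eq times_ta.abs_eq free_gen_def mult_single plus_free_word_def)
qed

lemma ta_induct [case_names word add]:
  assumes word: "\<And>c ws. P (c *\<^sub>C prod_list (map ta_gen ws))"
    and add: "\<And>s t. P s \<Longrightarrow> P t \<Longrightarrow> P (s + t)"
  shows "P t"
proof -
  have "P (abs_ta p)" for p
  proof (induction p rule: poly_mapping_single_induct)
    case (single k c)
    have "Poly_Mapping.single k c = c *\<^sub>C Poly_Mapping.single (FreeWord (letters k)) 1"
      by (simp add: scaleC_single scaleC_complex_def)
    then have "abs_ta (Poly_Mapping.single k c) = c *\<^sub>C prod_list (map ta_gen (letters k))"
      by (simp add: scaleC_ta.abs_eq prod_list_ta_gen)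
    then show ?case using word by simp
  next
    case (add f g)
    then show ?case using assms(2)[of "abs_ta f" "abs_ta g"] by (simp add: plus_ta.abs_eq)
  qed
  then show ?thesis by (metis ta_rep_exhaust)
qed

lemma ta_ext_word: "word_multilinear f \<Longrightarrow> ta_ext f (prod_list (map ta_gen ws)) = f ws"
  by (simp add: prod_list_ta_gen ta_ext_abs lin_ext_single scaleC_one)


section \<open>The universal enveloping algebra\<close>

definition uea_relators :: "'g::complex_lie_algebra ta set"
  where "uea_relators = {ta_gen X * ta_gen Y - ta_gen Y * ta_gen X - ta_gen (lie_bracket X Y) |X Y. True}"

quotient_type (overloaded) 'g uea = "'g::complex_lie_algebra ta" /
  "\<lambda>x y. x - y \<in> two_sided_ideal uea_relators"
  morphisms rep_uea uea_proj
  unfolding two_sided_ideal_def by (rule equivp_diff_span)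

instantiation uea :: (complex_lie_algebra) complex_vector
begin
lift_definition zero_uea :: "'a uea" is 0 .
lift_definition plus_uea :: "'a uea \<Rightarrow> 'a uea \<Rightarrow> 'a uea" is "(+)"
  unfolding two_sided_ideal_def by (rule diff_span_add)
lift_definition uminus_uea :: "'a uea \<Rightarrow> 'a uea" is uminus
  unfolding two_sided_ideal_def by (rule diff_span_neg)
lift_definition minus_uea :: "'a uea \<Rightarrow> 'a uea \<Rightarrow> 'a uea" is "(-)"
  unfolding two_sided_ideal_def by (rule diff_span_diff)
lift_definition scaleC_uea :: "complex \<Rightarrow> 'a uea \<Rightarrow> 'a uea" is scaleC
  unfolding two_sided_ideal_def by (rule diff_span_scale)
instance
  by standard
    (transfer; simp add: two_sided_ideal_0 add.assoc scaleC_add_right scaleC_add_left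
      scaleC_scaleC scaleC_one)+
end

lemma uea_rep_exhaust: obtains p where "t = uea_proj p"
  by (rule that[of "rep_uea t"]) (rule Quotient3_abs_rep[OF Quotient3_uea, symmetric])

definition word_lie_compatible :: "('g::complex_lie_algebra list \<Rightarrow> 'b::complex_vector) \<Rightarrow> bool"
  where "word_lie_compatible f \<longleftrightarrow> word_multilinear f \<and>
    (\<forall>u w X Y. f (u @ [X, Y] @ w) - f (u @ [Y, X] @ w) = f (u @ [lie_bracket X Y] @ w))"

text \<open>For \<open>f\<close> satisfying \<open>word_lie_compatible\<close>, \<open>uea_ext f\<close> is the linear map with
  \<open>X\<^sub>1 \<cdots> X\<^sub>n \<mapsto> f [X\<^sub>1, \<dots>, X\<^sub>n]\<close>.\<close>

definition uea_ext :: "('g::complex_lie_algebra list \<Rightarrow> 'b::complex_vector) \<Rightarrow> 'g uea \<Rightarrow> 'b"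
  where "uea_ext f u = ta_ext f (rep_uea u)"

lemma ta_ext_uea_ideal:
  fixes f :: "'g::complex_lie_algebra list \<Rightarrow> 'b::complex_vector"
  assumes f: "word_lie_compatible f" and x: "x \<in> two_sided_ideal uea_relators"
  shows "ta_ext f x = 0"
  using x unfolding two_sided_ideal_def
proof (rule clinear_eq_0_on_span[OF clinear_ta_ext, rotated 2])
  show ml: "word_multilinear f" using f by (simp add: word_lie_compatible_def)
  note lin = clinear_ta_ext[OF ml]
  fix x :: "'g ta" assume "x \<in> {a * r * b |a r b. r \<in> uea_relators}"
  then obtain a X Y b where
    x: "x = a * (ta_gen X * ta_gen Y - ta_gen Y * ta_gen X - ta_gen (lie_bracket X Y)) * b"
    unfolding uea_relators_def by blast
  have "ta_ext f (a * (ta_gen X * ta_gen Y - ta_gen Y * ta_gen X - ta_gen (lie_bracket X Y)) * b) = 0"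
    (is "ta_ext f (a * ?r * b) = 0")
  proof (induction a rule: ta_induct)
    case a: (word c u)
    show ?case
    proof (induction b rule: ta_induct)
      case b: (word d w)
      let ?p = "\<lambda>ws. prod_list (map ta_gen ws)"
      have "?p u * ?r * ?p w
          = ?p (u @ [X, Y] @ w) - ?p (u @ [Y, X] @ w) - ?p (u @ [lie_bracket X Y] @ w)"
        by (simp add: right_diff_distrib left_diff_distrib mult.assoc)
      then have "ta_ext f (?p u * ?r * ?p w) = 0"
        using f by (simp only: clinear_diff[OF lin] ta_ext_word[OF ml])
          (simp add: word_lie_compatible_def)
      then show ?case
        by (simp only: scaleC_mult_left scaleC_mult_right clinear_scale[OF lin]
            complex_vector.scale_zero_right)
    qed (simp add: distrib_left clinear_add[OF lin])
  qed (simp add: distrib_right clinear_add[OF lin])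
  then show "ta_ext f x = 0" by (simp add: x)
qed

lemma uea_ext_proj:
  assumes "word_lie_compatible f"
  shows "uea_ext f (uea_proj t) = ta_ext f t"
proof -
  have ml: "word_multilinear f" using assms by (simp add: word_lie_compatible_def)
  have "uea_proj (rep_uea (uea_proj t)) = uea_proj t"
    by (rule Quotient3_abs_rep[OF Quotient3_uea])
  then have "rep_uea (uea_proj t) - t \<in> two_sided_ideal uea_relators"
    by (simp only: uea.abs_eq_iff)
  then have "ta_ext f (rep_uea (uea_proj t) - t) = 0"
    by (rule ta_ext_uea_ideal[OF assms])
  then show ?thesis by (simp add: uea_ext_def clinear_diff[OF clinear_ta_ext[OF ml]])
qed

lemma clinear_uea_ext:
  fixes f :: "'g::complex_lie_algebra list \<Rightarrow> 'b::complex_vector"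
  assumes "word_lie_compatible f" shows "clinear (uea_ext f)"
proof (rule clinearI)
  fix s t :: "'g uea" and c
  note lin = clinear_ta_ext[OF assms[unfolded word_lie_compatible_def, THEN conjunct1]]
  obtain p q where s: "s = uea_proj p" and t: "t = uea_proj q"
    by (metis uea_rep_exhaust)
  show "uea_ext f (s + t) = uea_ext f s + uea_ext f t"
    by (simp add: s t plus_uea.abs_eq uea_ext_proj[OF assms] clinear_add[OF lin])
  show "uea_ext f (c *\<^sub>C s) = c *\<^sub>C uea_ext f s"
    by (simp add: s scaleC_uea.abs_eq uea_ext_proj[OF assms] clinear_scale[OF lin])
qed

instantiation uea :: (complex_lie_algebra) complex_algebra_1
begin
lift_definition one_uea :: "'a uea" is 1 .
lift_definition times_uea :: "'a uea \<Rightarrow> 'a uea \<Rightarrow> 'a uea" is "(*)"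
proof -
  fix x x' y y' :: "'a ta"
  assume "x - x' \<in> two_sided_ideal uea_relators" "y - y' \<in> two_sided_ideal uea_relators"
  then have "(x - x') * y + x' * (y - y') \<in> two_sided_ideal uea_relators"
    by (intro two_sided_ideal_add two_sided_ideal_mult_left two_sided_ideal_mult_right)
  moreover have "(x - x') * y + x' * (y - y') = x * y - x' * y'"
    by (simp add: algebra_simps)
  ultimately show "x * y - x' * y' \<in> two_sided_ideal uea_relators" by simp
qed
instance
proof
  show "(0 :: 'a uea) \<noteq> 1"
  proof
    let ?f = "\<lambda>ws :: 'a list. if ws = [] then 1 else 0 :: complex"
    assume eq: "(0 :: 'a uea) = 1"
    have f: "word_lie_compatible ?f"
      by (simp add: word_lie_compatible_def word_multilinear_def clinear_iff)
    have "uea_ext ?f (uea_proj (prod_list (map ta_gen []))) = 1"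
      using f by (subst uea_ext_proj[OF f], subst ta_ext_word) (auto simp: word_lie_compatible_def)
    then show False
      using eq clinear_0[OF clinear_uea_ext[OF f]] by (simp add: one_uea.abs_eq)
  qed
qed (transfer; simp add: two_sided_ideal_0 algebra_simps scaleC_mult_left scaleC_mult_right)+
end

definition uea_gen :: "'g::complex_lie_algebra \<Rightarrow> 'g uea"
  where "uea_gen X = uea_proj (ta_gen X)"

lemma clinear_uea_proj: "clinear uea_proj"
  by (rule clinearI) (simp_all add: plus_uea.abs_eq scaleC_uea.abs_eq)

lemma clinear_uea_gen: "clinear uea_gen"
  unfolding uea_gen_def by (rule clinear_compose[OF clinear_ta_gen clinear_uea_proj])

lemma uea_gen_bracket:
  "uea_gen X * uea_gen Y - uea_gen Y * uea_gen X = uea_gen (lie_bracket X Y)"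
proof -
  have "uea_proj (ta_gen X * ta_gen Y - ta_gen Y * ta_gen X) = uea_proj (ta_gen (lie_bracket X Y))"
    unfolding uea.abs_eq_iff by (rule two_sided_ideal_base) (auto simp: uea_relators_def)
  then show ?thesis
    by (simp add: uea_gen_def times_uea.abs_eq minus_uea.abs_eq)
qed

lemma uea_proj_word: "uea_proj (prod_list (map ta_gen ws)) = prod_list (map uea_gen ws)"
  by (induction ws) (simp_all add: one_uea.abs_eq uea_gen_def times_uea.abs_eq[symmetric])

lemma uea_induct [case_names word add]:
  assumes word: "\<And>c ws. P (c *\<^sub>C prod_list (map uea_gen ws))"
    and add: "\<And>s t. P s \<Longrightarrow> P t \<Longrightarrow> P (s + t)"
  shows "P t"
proof -
  have "P (uea_proj p)" for p
  proof (induction p rule: ta_induct)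
    case (word c ws)
    show ?case
      using assms(1)[of c ws] by (simp add: scaleC_uea.abs_eq[symmetric] uea_proj_word)
  next
    case (add f g)
    then show ?case using assms(2)[of "uea_proj f" "uea_proj g"] by (simp add: plus_uea.abs_eq)
  qed
  then show ?thesis by (metis uea_rep_exhaust)
qed

lemma uea_ext_word:
  assumes "word_lie_compatible f" shows "uea_ext f (prod_list (map uea_gen ws)) = f ws"
proof -
  have "word_multilinear f" using assms by (simp add: word_lie_compatible_def)
  then show ?thesis
    by (simp only: uea_proj_word[symmetric] uea_ext_proj[OF assms] ta_ext_word)
qed

definition uea_comult :: "'g::complex_lie_algebra uea \<Rightarrow> ('g uea, 'g uea) tensor"
  where "uea_comult = uea_ext (\<lambda>ws. prod_list (map (\<lambda>X. uea_gen X \<otimes> 1 + 1 \<otimes> uea_gen X) ws))"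

definition uea_antipode :: "'g::complex_lie_algebra uea \<Rightarrow> 'g uea"
  where "uea_antipode = uea_ext (\<lambda>ws. prod_list (map (\<lambda>X. - uea_gen X) (rev ws)))"

lemma word_lie_compatible_prod_list:
  fixes \<phi> :: "'g::complex_lie_algebra \<Rightarrow> 'b::complex_algebra_1"
  assumes "clinear \<phi>" and br: "\<And>X Y. \<phi> X * \<phi> Y - \<phi> Y * \<phi> X = \<phi> (lie_bracket X Y)"
  shows "word_lie_compatible (\<lambda>ws. prod_list (map \<phi> ws))"
  using assms(1)
  by (simp add: word_lie_compatible_def word_multilinear_def clinear_iff distrib_left distrib_right
      scaleC_mult_left scaleC_mult_right br[symmetric] left_diff_distrib right_diff_distrib mult.assoc)

lemma word_lie_compatible_prod_list_rev:
  fixes \<phi> :: "'g::complex_lie_algebra \<Rightarrow> 'b::complex_algebra_1"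
  assumes "clinear \<phi>" and br: "\<And>X Y. \<phi> Y * \<phi> X - \<phi> X * \<phi> Y = \<phi> (lie_bracket X Y)"
  shows "word_lie_compatible (\<lambda>ws. prod_list (map \<phi> (rev ws)))"
  using assms(1)
  by (simp add: word_lie_compatible_def word_multilinear_def clinear_iff distrib_left distrib_right
      scaleC_mult_left scaleC_mult_right br[symmetric] left_diff_distrib right_diff_distrib mult.assoc)

lemma uea_comult_compatible:
  "word_lie_compatible (\<lambda>ws. prod_list (map (\<lambda>X. uea_gen X \<otimes> 1 + 1 \<otimes> uea_gen X) ws))"
proof (rule word_lie_compatible_prod_list)
  show "clinear (\<lambda>X. uea_gen X \<otimes> 1 + 1 \<otimes> uea_gen X)"
    by (simp add: clinear_iff clinear_add[OF clinear_uea_gen] clinear_scale[OF clinear_uea_gen] tensor_add_left tensor_add_right tensor_scale_left tensor_scale_right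
        scaleC_add_right add_ac)
  fix X Y :: 'a
  have 1: "a \<otimes> b - a' \<otimes> b = (a - a') \<otimes> b" for a a' b :: "'a uea"
    using tensor_add_left[of "a - a'" a' b] by (simp add: algebra_simps)
  have 2: "b \<otimes> a - b \<otimes> a' = b \<otimes> (a - a')" for a a' b :: "'a uea"
    using tensor_add_right[of b "a - a'" a'] by (simp add: algebra_simps)
  show "(uea_gen X \<otimes> 1 + 1 \<otimes> uea_gen X) * (uea_gen Y \<otimes> 1 + 1 \<otimes> uea_gen Y)
      - (uea_gen Y \<otimes> 1 + 1 \<otimes> uea_gen Y) * (uea_gen X \<otimes> 1 + 1 \<otimes> uea_gen X)
    = uea_gen (lie_bracket X Y) \<otimes> 1 + 1 \<otimes> uea_gen (lie_bracket X Y)"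
    by (simp add: distrib_left distrib_right tensor_times_tensor uea_gen_bracket[symmetric]
        1[symmetric] 2[symmetric])
qed

lemma uea_antipode_compatible:
  "word_lie_compatible (\<lambda>ws. prod_list (map (\<lambda>X. - uea_gen X) (rev ws)))"
  by (rule word_lie_compatible_prod_list_rev)
    (simp_all add: clinear_iff clinear_add[OF clinear_uea_gen] clinear_scale[OF clinear_uea_gen]
      uea_gen_bracket[symmetric])

lemma clinear_uea_comult: "clinear uea_comult"
  unfolding uea_comult_def by (rule clinear_uea_ext[OF uea_comult_compatible])

lemma clinear_uea_antipode: "clinear uea_antipode"
  unfolding uea_antipode_def by (rule clinear_uea_ext[OF uea_antipode_compatible])

lemma uea_comult_one: "uea_comult 1 = 1 \<otimes> 1"
  using uea_ext_word[OF uea_comult_compatible, of "[]"] by (simp add: uea_comult_def one_tensor_def)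

lemma uea_comult_gen: "uea_comult (uea_gen X) = uea_gen X \<otimes> 1 + 1 \<otimes> uea_gen X"
  using uea_ext_word[OF uea_comult_compatible, of "[X]"] by (simp add: uea_comult_def)

lemma uea_antipode_one: "uea_antipode 1 = 1"
  using uea_ext_word[OF uea_antipode_compatible, of "[]"] by (simp add: uea_antipode_def)

lemma uea_antipode_gen: "uea_antipode (uea_gen X) = - uea_gen X"
  using uea_ext_word[OF uea_antipode_compatible, of "[X]"] by (simp add: uea_antipode_def)

lemma uea_comult_mult: "uea_comult (a * b) = uea_comult a * uea_comult b"
proof (induction a rule: uea_induct)
  case a: (word c u)
  show ?case
  proof (induction b rule: uea_induct)
    case b: (word d w)
    have "uea_comult (prod_list (map uea_gen u) * prod_list (map uea_gen w))
        = uea_comult (prod_list (map uea_gen u)) * uea_comult (prod_list (map uea_gen w))"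
      using uea_ext_word[OF uea_comult_compatible, of "u @ w"]
      by (simp add: uea_comult_def uea_ext_word[OF uea_comult_compatible])
    then show ?case
      by (simp add: scaleC_mult_left scaleC_mult_right clinear_scale[OF clinear_uea_comult])
  qed (simp add: distrib_left clinear_add[OF clinear_uea_comult])
qed (simp add: distrib_right clinear_add[OF clinear_uea_comult])

lemma uea_antipode_mult: "uea_antipode (a * b) = uea_antipode b * uea_antipode a"
proof (induction a rule: uea_induct)
  case a: (word c u)
  show ?case
  proof (induction b rule: uea_induct)
    case b: (word d w)
    have "uea_antipode (prod_list (map uea_gen u) * prod_list (map uea_gen w))
        = uea_antipode (prod_list (map uea_gen w)) * uea_antipode (prod_list (map uea_gen u))"
      using uea_ext_word[OF uea_antipode_compatible, of "u @ w"]
      by (simp add: uea_antipode_def uea_ext_word[OF uea_antipode_compatible])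
    then show ?case
      by (simp add: scaleC_mult_left scaleC_mult_right clinear_scale[OF clinear_uea_antipode]
          scaleC_scaleC mult.commute)
  qed (simp add: distrib_left distrib_right clinear_add[OF clinear_uea_antipode])
qed (simp add: distrib_left distrib_right clinear_add[OF clinear_uea_antipode])


section \<open>Modules and comodules\<close>

definition right_lie_module :: "('v::complex_vector \<Rightarrow> 'g::complex_lie_algebra \<Rightarrow> 'v) \<Rightarrow> bool"
  where "right_lie_module act \<longleftrightarrow> cbilinear act \<and>
    (\<forall>v X Y. act v (lie_bracket X Y) = act (act v X) Y - act (act v Y) X)"

text \<open>\<open>v \<cdot> (X\<^sub>1 \<cdots> X\<^sub>n) = (\<cdots>(v \<cdot> X\<^sub>1) \<cdots>) \<cdot> X\<^sub>n\<close>\<close>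

definition uea_act ::
    "('v::complex_vector \<Rightarrow> 'g::complex_lie_algebra \<Rightarrow> 'v) \<Rightarrow> 'v \<Rightarrow> 'g uea \<Rightarrow> 'v"
  where "uea_act act v = uea_ext (foldl act v)"

lemma clinear_foldl:
  assumes "cbilinear act" shows "clinear (\<lambda>v. foldl act v ws)"
  using assms by (induction ws) (simp_all add: clinear_iff cbilinear_iff)

lemma uea_act_compatible:
  assumes "right_lie_module act" shows "word_lie_compatible (foldl act v)"
proof -
  have bil: "cbilinear act" using assms by (simp add: right_lie_module_def)
  note lin = clinear_foldl[OF bil]
  show ?thesis
    unfolding word_lie_compatible_def word_multilinear_def
  proof (intro conjI allI)
    fix u w :: "'b list"
    have "clinear (act (foldl act v u))" using bil by (simp add: cbilinear_def)
    then have "clinear (\<lambda>X. foldl act (act (foldl act v u) X) w)"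
      by (rule clinear_compose) (rule lin)
    then show "clinear (\<lambda>X. foldl act v (u @ [X] @ w))" by simp
    fix X Y
    show "foldl act v (u @ [X, Y] @ w) - foldl act v (u @ [Y, X] @ w)
        = foldl act v (u @ [lie_bracket X Y] @ w)"
      using assms by (simp add: right_lie_module_def clinear_diff[OF lin])
  qed
qed

lemma cbilinear_uea_act:
  assumes "right_lie_module act" shows "cbilinear (uea_act act)"
  unfolding cbilinear_def
proof (intro conjI allI)
  have bil: "cbilinear act" using assms by (simp add: right_lie_module_def)
  note lin = clinear_uea_ext[OF uea_act_compatible[OF assms]]
  show "clinear (uea_act act v)" for v
    unfolding uea_act_def by (rule lin)
  show "clinear (\<lambda>v. uea_act act v u)" for u
  proof (induction u rule: uea_induct)
    case (word c ws)
    have "clinear (\<lambda>v. c *\<^sub>C foldl act v ws)"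
      using clinear_foldl[OF bil, of ws]
      by (simp add: clinear_iff scaleC_add_right scaleC_scaleC mult.commute)
    then show ?case
      by (simp add: uea_act_def clinear_scale[OF lin] uea_ext_word[OF uea_act_compatible[OF assms]])
  next
    case (add s t)
    then show ?case
      by (simp add: uea_act_def clinear_add[OF lin] complex_vector_pair.linear_compose_add)
  qed
qed

lemma uea_act_one: "right_lie_module act \<Longrightarrow> uea_act act v 1 = v"
  using uea_ext_word[OF uea_act_compatible, of act v "[]"] by (simp add: uea_act_def)

lemma uea_act_gen: "right_lie_module act \<Longrightarrow> uea_act act v (uea_gen X) = act v X"
  using uea_ext_word[OF uea_act_compatible, of act v "[X]"] by (simp add: uea_act_def)

lemma uea_act_mult:
  assumes "right_lie_module act"
  shows "uea_act act v (a * b) = uea_act act (uea_act act v a) b"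
proof -
  have bil: "cbilinear (uea_act act)" by (rule cbilinear_uea_act[OF assms])
  show ?thesis
  proof (induction a rule: uea_induct)
    case a: (word c u)
    show ?case
    proof (induction b rule: uea_induct)
      case b: (word d w)
      have "uea_act act v (prod_list (map uea_gen u) * prod_list (map uea_gen w))
          = uea_act act (uea_act act v (prod_list (map uea_gen u))) (prod_list (map uea_gen w))"
        using uea_ext_word[OF uea_act_compatible[OF assms], of v "u @ w"]
        by (simp add: uea_act_def uea_ext_word[OF uea_act_compatible[OF assms]])
      then show ?case
        using bil by (simp add: scaleC_mult_left scaleC_mult_right cbilinear_iff)
    qed (use bil in \<open>simp add: distrib_left cbilinear_iff\<close>)
  qed (use bil in \<open>simp add: distrib_right cbilinear_iff\<close>)
qed

definition left_lie_comodule ::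
    "('v::complex_vector \<Rightarrow> ('g::complex_lie_algebra, 'v) tensor) \<Rightarrow> bool"
  where "left_lie_comodule nab \<longleftrightarrow> clinear nab \<and>
    (\<forall>v. tensor_lift (\<lambda>X. tensor_map (\<lambda>Y. X \<and>\<^sub>2 Y) id) (tensor_map id nab (nab v)) = 0)"

text \<open>The iterate \<open>v\<^sub>[\<^sub>-\<^sub>k\<^sub>] \<otimes> \<cdots> \<otimes> v\<^sub>[\<^sub>-\<^sub>1\<^sub>] \<otimes> v\<^sub>[\<^sub>0\<^sub>]\<close>, as an element of
  the direct summand \<open>\<gg>\<^sup>\<otimes>\<^sup>k \<otimes> V\<close> of \<open>T(\<gg>) \<otimes> V\<close>.\<close>

primrec coact_iter ::
    "('v::complex_vector \<Rightarrow> ('g::complex_lie_algebra, 'v) tensor) \<Rightarrow> nat \<Rightarrow> 'v \<Rightarrow> ('g ta, 'v) tensor"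
  where
    "coact_iter nab 0 = (\<lambda>v. 1 \<otimes> v)"
  | "coact_iter nab (Suc k) =
      (\<lambda>v. tensor_lift (\<lambda>X w. tensor_map (\<lambda>t. ta_gen X * t) id (coact_iter nab k w)) (nab v))"

definition locally_conilpotent ::
    "('v::complex_vector \<Rightarrow> ('g::complex_lie_algebra, 'v) tensor) \<Rightarrow> bool"
  where "locally_conilpotent nab \<longleftrightarrow> (\<forall>v. \<exists>n. coact_iter nab n v = 0)"

lemma clinear_ta_gen_mult: "clinear (\<lambda>t. ta_gen X * t)"
  by (simp add: clinear_iff distrib_left scaleC_mult_right)

lemma clinear_mult_ta_gen: "clinear (\<lambda>X. t * ta_gen X)"
  by (simp add: clinear_iff clinear_add[OF clinear_ta_gen] clinear_scale[OF clinear_ta_gen]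
      distrib_left scaleC_mult_right)

lemma clinear_id: "clinear id"
  by (simp add: clinear_iff)

lemma tensor_map_fun_add_left: "tensor_map (\<lambda>a. f a + f' a) g t = tensor_map f g t + tensor_map f' g t"
  by (simp add: tensor_map_def tensor_add_left tensor_lift_fun_add)

lemma tensor_map_fun_scale_left: "tensor_map (\<lambda>a. c *\<^sub>C f a) g t = c *\<^sub>C tensor_map f g t"
  by (simp add: tensor_map_def tensor_scale_left tensor_lift_fun_scale)

lemma cbilinear_coact_iter_step:
  fixes F :: "'v::complex_vector \<Rightarrow> ('g::complex_lie_algebra ta, 'v) tensor"
  assumes "clinear F"
  shows "cbilinear (\<lambda>X w. tensor_map (\<lambda>t. ta_gen X * t) id (F w))"
proof -
  note lin = clinear_tensor_map[OF clinear_ta_gen_mult clinear_id]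
  show ?thesis
    by (rule cbilinearI)
      (simp_all add: clinear_add[OF assms] clinear_scale[OF assms] clinear_add[OF lin]
        clinear_scale[OF lin] clinear_add[OF clinear_ta_gen] clinear_scale[OF clinear_ta_gen]
        distrib_right scaleC_mult_left tensor_map_fun_add_left tensor_map_fun_scale_left)
qed

lemma clinear_coact_iter:
  assumes "clinear nab" shows "clinear (coact_iter nab k)"
proof (induction k)
  case 0
  show ?case by (simp add: clinear_iff tensor_add_right tensor_scale_right)
next
  case (Suc k)
  show ?case
    using clinear_compose[OF assms clinear_tensor_lift[OF cbilinear_coact_iter_step[OF Suc]]]
    by simp
qed

lemma cbilinear_coact_iter_step_right:
  fixes nab :: "'v::complex_vector \<Rightarrow> ('g::complex_lie_algebra, 'v) tensor"
  assumes nab: "clinear nab"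
  shows "cbilinear (\<lambda>t w. tensor_map (\<lambda>X. t * ta_gen X) id (nab w))"
proof -
  note lin = clinear_tensor_map[OF clinear_mult_ta_gen clinear_id]
  show ?thesis
    by (rule cbilinearI)
      (simp_all add: clinear_add[OF nab] clinear_scale[OF nab] clinear_add[OF lin]
        clinear_scale[OF lin] distrib_right scaleC_mult_left tensor_map_fun_add_left
        tensor_map_fun_scale_left)
qed

lemma coact_iter_Suc_right:
  fixes nab :: "'v::complex_vector \<Rightarrow> ('g::complex_lie_algebra, 'v) tensor"
  assumes nab: "clinear nab"
  shows "coact_iter nab (Suc k) v =
    tensor_lift (\<lambda>t w. tensor_map (\<lambda>X. t * ta_gen X) id (nab w)) (coact_iter nab k v)"
proof -
  define R :: "('g ta, 'v) tensor \<Rightarrow> ('g ta, 'v) tensor"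
    where "R = tensor_lift (\<lambda>t w. tensor_map (\<lambda>X. t * ta_gen X) id (nab w))"
  have linr: "clinear (tensor_map (\<lambda>X. t * ta_gen X) (id :: 'v \<Rightarrow> 'v))" for t :: "'g ta"
    by (rule clinear_tensor_map[OF clinear_mult_ta_gen clinear_id])
  have linl: "clinear (tensor_map (\<lambda>t. ta_gen X * t) (id :: 'v \<Rightarrow> 'v))" for X :: 'g
    by (rule clinear_tensor_map[OF clinear_ta_gen_mult clinear_id])
  note bil = cbilinear_coact_iter_step_right[OF nab]
  have R: "clinear R" unfolding R_def by (rule clinear_tensor_lift[OF bil])
  have R_tensor: "R (t \<otimes> w) = tensor_map (\<lambda>X. t * ta_gen X) id (nab w)" for t w
    unfolding R_def by (rule tensor_lift_tensor[OF bil])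
  have comm0: "tensor_map (\<lambda>t. ta_gen X * t) id (tensor_map (\<lambda>Y. t * ta_gen Y) id s)
      = tensor_map (\<lambda>Y. ta_gen X * t * ta_gen Y) id s" for X t and s :: "('g, 'v) tensor"
  proof (induction s rule: tensor_induct)
    case (tensor a b)
    show ?case
      by (simp only: tensor_map_tensor[OF clinear_mult_ta_gen clinear_id]
          tensor_map_tensor[OF clinear_ta_gen_mult clinear_id]) (simp add: mult.assoc)
  qed (simp only: clinear_add[OF linr] clinear_add[OF linl])
  have comm: "tensor_map (\<lambda>t. ta_gen X * t) id (R s) = R (tensor_map (\<lambda>t. ta_gen X * t) id s)" for X s
  proof (induction s rule: tensor_induct)
    case (tensor a b)
    show ?case
      by (simp only: R_tensor comm0 tensor_map_tensor[OF clinear_ta_gen_mult clinear_id])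
        (simp add: mult.assoc)
  qed (simp only: clinear_add[OF R] clinear_add[OF linl])
  have "coact_iter nab (Suc k) v = R (coact_iter nab k v)"
  proof (induction k arbitrary: v)
    case 0
    have "tensor_lift (\<lambda>X w. tensor_map (\<lambda>t. ta_gen X * t) id (1 \<otimes> w)) s
        = tensor_map ta_gen id s" for s :: "('g, 'v) tensor"
      by (simp add: tensor_map_tensor clinear_ta_gen_mult clinear_id tensor_map_def[of ta_gen])
    then show ?case by (simp add: R_tensor)
  next
    case (Suc k)
    note bl = cbilinear_coact_iter_step[OF clinear_coact_iter[OF nab]]
    have "tensor_lift (\<lambda>X w. tensor_map (\<lambda>t. ta_gen X * t) id (coact_iter nab (Suc k) w)) s
        = R (tensor_lift (\<lambda>X w. tensor_map (\<lambda>t. ta_gen X * t) id (coact_iter nab k w)) s)" for s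
    proof (induction s rule: tensor_induct)
      case (tensor X w)
      show ?case by (simp only: tensor_lift_tensor[OF bl]) (simp only: Suc comm)
    qed (simp only: clinear_add[OF clinear_tensor_lift[OF bl]] clinear_add[OF R])
    then show ?case by (simp only: coact_iter.simps(2)[of nab "Suc k"] coact_iter.simps(2)[of nab k])
  qed
  then show ?thesis by (simp only: R_def)
qed

lemma coact_iter_eq_0_mono:
  assumes "clinear nab" "coact_iter nab n v = 0" "n \<le> k"
  shows "coact_iter nab k v = 0"
  using assms(3)
proof (induction k rule: dec_induct)
  case (step k)
  then show ?case
    by (simp only: coact_iter_Suc_right[OF assms(1)]
        clinear_0[OF clinear_tensor_lift[OF cbilinear_coact_iter_step_right[OF assms(1)]]])
qed (rule assms(2))

lemma finite_coact_iter_support: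
  assumes "clinear nab" "locally_conilpotent nab"
  shows "finite {k. k \<ge> 1 \<and> coact_iter nab k v \<noteq> 0}"
proof -
  obtain n where "coact_iter nab n v = 0"
    using assms(2) by (auto simp: locally_conilpotent_def)
  then have "{k. k \<ge> 1 \<and> coact_iter nab k v \<noteq> 0} \<subseteq> {..<n}"
    using coact_iter_eq_0_mono[OF assms(1)] by (auto simp: not_le[symmetric])
  then show ?thesis by (rule finite_subset) simp
qed

text \<open>By \<open>finite_coact_iter_support\<close> the index set below is finite for locally conilpotent
  \<open>nab\<close>, so the sum is the full series.\<close>

definition uea_coact ::
    "('v::complex_vector \<Rightarrow> ('g::complex_lie_algebra, 'v) tensor) \<Rightarrow> 'v \<Rightarrow> ('g uea, 'v) tensor"
  where "uea_coact nab v = 1 \<otimes> v +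
    (\<Sum>k | k \<ge> 1 \<and> coact_iter nab k v \<noteq> 0.
      (1 / fact k) *\<^sub>C tensor_map uea_proj id (coact_iter nab k v))"


section \<open>Anti-Yetter-Drinfeld modules\<close>

definition AYD_lie ::
    "('v::complex_vector \<Rightarrow> 'g::complex_lie_algebra \<Rightarrow> 'v) \<Rightarrow> ('v \<Rightarrow> ('g, 'v) tensor) \<Rightarrow> bool"
  where "AYD_lie act nab \<longleftrightarrow>
    (\<forall>v X. nab (act v X) =
      tensor_map id (\<lambda>w. act w X) (nab v) + tensor_map (\<lambda>Y. lie_bracket Y X) id (nab v))"

text \<open>\<open>(id \<otimes> \<Delta>)(\<Delta> h) = h\<^sub>1 \<otimes> (h\<^sub>2 \<otimes> h\<^sub>3)\<close>\<close>

definition AYD_uea ::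
    "('v::complex_vector \<Rightarrow> 'g::complex_lie_algebra uea \<Rightarrow> 'v) \<Rightarrow> ('v \<Rightarrow> ('g uea, 'v) tensor) \<Rightarrow> bool"
  where "AYD_uea uact unab \<longleftrightarrow>
    (\<forall>v h. unab (uact v h) =
      tensor_lift
        (\<lambda>h1. tensor_lift (\<lambda>h2 h3. tensor_map (\<lambda>u. uea_antipode h3 * u * h1) (\<lambda>w. uact w h2) (unab v)))
        (tensor_map id uea_comult (uea_comult h)))"

end

theory Submission
  imports Defs
begin

text \<open>
  Both conditions only need to be tested on generators: the right hand side of the condition over
  \<open>U(\<gg>)\<close> is a right action of \<open>U(\<gg>)\<close>, so it reduces to
  \<open>\<nabla>(v \<cdot> X) = v\<^sub>\<langle>\<^sub>-\<^sub>1\<^sub>\<rangle> \<otimes> v\<^sub>\<langle>\<^sub>0\<^sub>\<rangle> \<cdot> X + [v\<^sub>\<langle>\<^sub>-\<^sub>1\<^sub>\<rangle>, X] \<otimes> v\<^sub>\<langle>\<^sub>0\<^sub>\<rangle>\<close>.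
  Since \<open>[\<cdot>, X]\<close> is a derivation, this follows from the condition over \<open>\<gg>\<close> by comparing the
  iterated coactions degree by degree.

  Conversely, there is an \<open>ad\<close>-equivariant linear map \<open>\<pi> : U(\<gg>) \<rightarrow> \<gg>\<close> with \<open>\<pi>(X) = X\<close> that
  vanishes on 1 and on the images of symmetric tensors of degree at least 2. The comodule condition
  says that the iterated coactions are symmetric, so \<open>(\<pi> \<otimes> id) \<nabla> = \<nabla>\<^sub>\<gg>\<close>, and applying \<open>\<pi> \<otimes> id\<close> to the
  condition over \<open>U(\<gg>)\<close> gives the one over \<open>\<gg>\<close>.

  The existence of \<open>\<pi>\<close> is the part of the Poincare-Birkhoff-Witt theorem that is needed. On words of
  length \<open>n\<close> it has to satisfy \<open>\<pi>(u X Y w) - \<pi>(u Y X w) = \<pi>(u [X, Y] w)\<close>, whose right hand side is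
  known by induction and is a 1-cocycle of the symmetric group in its Coxeter presentation (the
  braid relation is the Jacobi identity). In characteristic 0 a cocycle has a primitive, obtained by
  averaging; the averaging formula is natural enough to inherit multilinearity, equivariance and the
  vanishing on symmetric tensors.
\<close>

section \<open>Primitives of cocycles of the symmetric group\<close>

text \<open>\<open>s j\<close> exchanges the letters at positions \<open>j\<close> and \<open>j + 1\<close>, and a primitive \<open>F\<close> of \<open>b\<close> has to satisfy
  \<open>F w - F (s j w) = b j w\<close>. If \<open>F\<close> does so for all \<open>j > k\<close>, then \<open>carry s b k F i w\<close> is the value at
  \<open>w\<close> that is forced by \<open>F\<close> at the word with the letter \<open>i\<close> moved to position \<open>k\<close>; the average over
  \<open>i \<ge> k\<close> satisfies it for \<open>j = k\<close> as well.\<close>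

primrec carry :: "(nat \<Rightarrow> 'o \<Rightarrow> 'o) \<Rightarrow> (nat \<Rightarrow> 'o \<Rightarrow> 'w::ab_group_add) \<Rightarrow> nat \<Rightarrow> ('o \<Rightarrow> 'w)
    \<Rightarrow> nat \<Rightarrow> 'o \<Rightarrow> 'w" where
  "carry s b k F 0 = F"
| "carry s b k F (Suc i) = (\<lambda>w. if i < k then F w else b i w + carry s b k F i (s i w))"

primrec primitive :: "(nat \<Rightarrow> 'o \<Rightarrow> 'o) \<Rightarrow> (nat \<Rightarrow> 'o \<Rightarrow> 'w::complex_vector) \<Rightarrow> nat
    \<Rightarrow> nat \<Rightarrow> 'o \<Rightarrow> 'w" where
  "primitive s b n 0 = (\<lambda>_. 0)"
| "primitive s b n (Suc l) = (\<lambda>w. (1 / of_nat (Suc l)) *\<^sub>C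
    (\<Sum>i = n - Suc l..<n. carry s b (n - Suc l) (primitive s b n l) i w))"

lemma carry_le: "i \<le> k \<Longrightarrow> carry s b k F i = F"
  by (cases i) auto

text \<open>The values of a 1-cocycle on the Coxeter generators. Each \<open>cocycle_\<close>
  assumption says that the increments \<open>b\<close> collected along the two sides of a Coxeter
  relation agree, as any primitive forces. In the application \<open>\<Omega>\<close> is the set of
  words of length \<open>n\<close>, outside of which exchanging letters by position is
  meaningless.\<close>

locale adjacent_cocycle =
  fixes n :: nat and \<Omega> :: "'o set" and s :: "nat \<Rightarrow> 'o \<Rightarrow> 'o"
    and b :: "nat \<Rightarrow> 'o \<Rightarrow> 'w::complex_vector"
  assumes closed: "w \<in> \<Omega> \<Longrightarrow> Suc j < n \<Longrightarrow> s j w \<in> \<Omega>"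
    and involutive: "w \<in> \<Omega> \<Longrightarrow> Suc j < n \<Longrightarrow> s j (s j w) = w"
    and far: "w \<in> \<Omega> \<Longrightarrow> Suc i < j \<Longrightarrow> Suc j < n \<Longrightarrow> s i (s j w) = s j (s i w)"
    and braid: "w \<in> \<Omega> \<Longrightarrow> Suc (Suc j) < n \<Longrightarrow>
      s j (s (Suc j) (s j w)) = s (Suc j) (s j (s (Suc j) w))"
    and cocycle_involutive: "w \<in> \<Omega> \<Longrightarrow> Suc j < n \<Longrightarrow> b j (s j w) = - b j w"
    and cocycle_far: "w \<in> \<Omega> \<Longrightarrow> Suc i < j \<Longrightarrow> Suc j < n \<Longrightarrow>
      b i w + b j (s i w) = b j w + b i (s j w)"
    and cocycle_braid: "w \<in> \<Omega> \<Longrightarrow> Suc (Suc j) < n \<Longrightarrow>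
      b j w + b (Suc j) (s j w) + b j (s (Suc j) (s j w))
      = b (Suc j) w + b j (s (Suc j) w) + b (Suc j) (s j (s (Suc j) w))"
begin

context
  fixes k :: nat and F :: "'o \<Rightarrow> 'w"
  assumes F: "\<And>w j. w \<in> \<Omega> \<Longrightarrow> k < j \<Longrightarrow> Suc j < n \<Longrightarrow> F w - F (s j w) = b j w"
begin

text \<open>Letter \<open>i\<close> travels left to position \<open>k\<close> through exchanges that
  commute with \<open>s j\<close>. The far relation pushes \<open>s j\<close> through them until the
  hypothesis on \<open>F\<close> applies.\<close>

lemma carry_swap_above:
  assumes "w \<in> \<Omega>" "k \<le> i" "i < j" "Suc j < n"
  shows "carry s b k F i w - carry s b k F i (s j w) = b j w"
  using assms(2,1,3)
proof (induction i arbitrary: w rule: dec_induct)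
  case base
  then show ?case using F assms(4) by (simp add: carry_le)
next
  case (step i)
  have "s i w \<in> \<Omega>" using closed step assms(4) by simp
  from step.IH[OF this] step.prems step.hyps
  have "carry s b k F i (s i w) - carry s b k F i (s i (s j w)) = b j (s i w)"
    using far[of w i j] assms(4) by simp
  with cocycle_far[of w i j] step assms(4) show ?case by (simp add: algebra_simps)
qed

text \<open>On its way left, letter \<open>i\<close> passes both exchanged letters, which turns
  \<open>s j\<close> into \<open>s (Suc j)\<close>. This is the braid relation, needed when
  \<open>i = j + 2\<close>; there \<open>carry_swap_above\<close> finishes. Larger \<open>i\<close>
  follow from the far relation.\<close>

lemma carry_swap_below:
  assumes "w \<in> \<Omega>" "k \<le> j" "Suc j < i" "i < n"
  shows "carry s b k F i w - carry s b k F i (s j w) = b j w"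
proof -
  have "Suc (Suc j) \<le> i" using assms(3) by simp
  then show ?thesis using assms(1,4)
  proof (induction i arbitrary: w rule: dec_induct)
    case base
    let ?j = "Suc j" and ?A = "carry s b k F j"
    have cl: "s ?j w \<in> \<Omega>" "s j (s ?j w) \<in> \<Omega>"
      using closed base by auto
    have "?A (s j (s ?j w)) - ?A (s ?j (s j (s ?j w))) = b ?j (s j (s ?j w))"
      by (rule carry_swap_above) (use cl assms base in auto)
    with cocycle_braid[of w j] braid[of w j] base assms(2) show ?case
      by (simp add: algebra_simps)
  next
    case (step i)
    have "s i w \<in> \<Omega>" using closed step by simp
    from step.IH[OF this] step.prems step.hyps
    have "carry s b k F i (s i w) - carry s b k F i (s i (s j w)) = b j (s i w)"
      using far[of w j i] by simp
    with cocycle_far[of w j i] step assms(2) show ?case by (simp add: algebra_simps)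
  qed
qed

lemma carry_swap_at:
  assumes "w \<in> \<Omega>" "k \<le> j" "Suc j < n"
  shows "carry s b k F (Suc j) w - carry s b k F j (s j w) = b j w"
    and "carry s b k F j w - carry s b k F (Suc j) (s j w) = b j w"
  using assms cocycle_involutive[of w j] involutive[of w j] by auto

text \<open>The transposition \<open>?t\<close> of \<open>j\<close> and \<open>Suc j\<close> matches
  the letters of \<open>w\<close> with those of \<open>s j w\<close>. Each of the
  \<open>n - k\<close> matched pairs of terms differs by exactly \<open>b j w\<close>.\<close>

lemma sum_carry_swap:
  assumes "w \<in> \<Omega>" "k \<le> j" "Suc j < n"
  shows "(\<Sum>i = k..<n. carry s b k F i w) - (\<Sum>i = k..<n. carry s b k F i (s j w))
    = of_nat (n - k) *\<^sub>C b j w"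
proof -
  let ?t = "\<lambda>i. if i = j then Suc j else if i = Suc j then j else i"
  have "(\<Sum>i = k..<n. carry s b k F i (s j w)) = (\<Sum>i = k..<n. carry s b k F (?t i) (s j w))"
    by (rule sum.reindex_bij_witness[of _ ?t ?t]) (use assms in auto)
  then have "(\<Sum>i = k..<n. carry s b k F i w) - (\<Sum>i = k..<n. carry s b k F i (s j w))
      = (\<Sum>i = k..<n. carry s b k F i w - carry s b k F (?t i) (s j w))"
    by (simp add: sum_subtractf)
  also have "\<dots> = (\<Sum>i = k..<n. b j w)"
  proof (rule sum.cong[OF refl])
    fix i assume i: "i \<in> {k..<n}"
    consider "i < j" | "i = j" | "i = Suc j" | "Suc j < i" by linarith
    then show "carry s b k F i w - carry s b k F (?t i) (s j w) = b j w"
      using i assms carry_swap_above[of w i j] carry_swap_below[of w j i] carry_swap_at[of w j]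
      by cases (auto simp del: carry.simps)
  qed
  also have "\<dots> = of_nat (n - k) *\<^sub>C b j w"
    by (simp add: complex_vector.sum_constant_scale)
  finally show ?thesis .
qed

end

text \<open>Stage \<open>l\<close> is correct on the positions \<open>j \<ge> n - l\<close>.
  Averaging over \<open>l\<close> terms cancels the factor from \<open>sum_carry_swap\<close>, and
  at \<open>l = n\<close> every position is covered.\<close>

lemma primitive_swap:
  assumes "l \<le> n" "w \<in> \<Omega>" "n - l \<le> j" "Suc j < n"
  shows "primitive s b n l w - primitive s b n l (s j w) = b j w"
  using assms
proof (induction l arbitrary: w j)
  case (Suc l)
  let ?k = "n - Suc l"
  have "(\<Sum>i = ?k..<n. carry s b ?k (primitive s b n l) i w)
      - (\<Sum>i = ?k..<n. carry s b ?k (primitive s b n l) i (s j w)) = of_nat (n - ?k) *\<^sub>C b j w"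
    by (rule sum_carry_swap) (use Suc in auto)
  moreover have "n - ?k = Suc l" using Suc.prems by simp
  ultimately show ?case
    by (simp only: primitive.simps complex_vector.scale_right_diff_distrib[symmetric])
      (simp add: scaleC_scaleC scaleC_one del: of_nat_Suc)
qed auto

end

text \<open>The averaging formula uses only the cocycle values, exchanges of adjacent letters, sums
  and scalars. A property stable under these therefore passes from the cocycle to its primitive;
  this is how multilinearity, equivariance and the vanishing on symmetric tensors are
  obtained.\<close>

lemma primitive_closure [consumes 1, case_names swap cocycle zero add scale]:
  assumes "l \<le> n"
    and swap: "\<And>Q j. P Q \<Longrightarrow> Suc j < n \<Longrightarrow> P (\<lambda>w. Q (s j w))"
    and cocycle: "\<And>j. Suc j < n \<Longrightarrow> P (b j)"
    and zero: "P (\<lambda>_. 0)"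
    and add: "\<And>Q R. P Q \<Longrightarrow> P R \<Longrightarrow> P (\<lambda>w. Q w + R w)"
    and scale: "\<And>Q c. P Q \<Longrightarrow> P (\<lambda>w. c *\<^sub>C Q w)"
  shows "P (primitive s b n l)"
  using assms(1)
proof (induction l)
  case (Suc l)
  then have F: "P (primitive s b n l)" by simp
  have carry: "P (carry s b k (primitive s b n l) i)" if "i < n" for i k
    using that
  proof (induction i)
    case (Suc i)
    have *: "P (\<lambda>w. b i w + carry s b k (primitive s b n l) i (s i w))"
      by (intro add cocycle swap Suc) (use Suc in auto)
    then show ?case using F by (cases "i < k") simp_all
  qed (simp add: F)
  have sum: "P (\<lambda>w. \<Sum>i\<in>I. carry s b k (primitive s b n l) i w)" if "finite I" "I \<subseteq> {..<n}" for I k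
    using that by (induction I rule: finite_induct) (auto intro: zero add carry)
  have "{n - Suc l..<n} \<subseteq> {..<n}" by auto
  then show ?case by (simp only: primitive.simps) (intro scale sum; simp)
qed (simp add: zero)

section \<open>Words in a Lie algebra\<close>

definition swap_at :: "nat \<Rightarrow> 'a list \<Rightarrow> 'a list" where
  "swap_at j w = take j w @ [w ! Suc j, w ! j] @ drop (Suc (Suc j)) w"

definition contract_at :: "nat \<Rightarrow> 'g::complex_lie_algebra list \<Rightarrow> 'g list" where
  "contract_at j w = take j w @ [lie_bracket (w ! j) (w ! Suc j)] @ drop (Suc (Suc j)) w"

lemma swap_at_append: "length u = j \<Longrightarrow> swap_at j (u @ x # y # w) = u @ y # x # w"
  by (auto simp: swap_at_def nth_append)

lemma contract_at_append:
  "length u = j \<Longrightarrow> contract_at j (u @ x # y # w) = u @ lie_bracket x y # w"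
  by (auto simp: contract_at_def nth_append)

lemma list_split_at2:
  assumes "Suc j < length w"
  obtains u x y v where "w = u @ x # y # v" "length u = j"
proof
  show "w = take j w @ w ! j # w ! Suc j # drop (Suc (Suc j)) w"
    using assms by (metis Cons_nth_drop_Suc Suc_lessD append_take_drop_id)
qed (use assms in simp)

lemma length_swap_at: "Suc j < length w \<Longrightarrow> length (swap_at j w) = length w"
  by (simp add: swap_at_def)

lemma length_contract_at: "Suc j < length w \<Longrightarrow> Suc (length (contract_at j w)) = length w"
  by (simp add: contract_at_def)

lemma list_split_far:
  assumes "Suc i < j" "Suc j < length w"
  obtains u x y v z t r where "w = u @ x # y # v @ z # t # r" "length u = i"
    "j = Suc (Suc (i + length v))"
proof -
  obtain u x y v where w: "w = u @ x # y # v" and u: "length u = i"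
    by (rule list_split_at2[of i w]) (use assms in auto)
  then have "Suc (j - Suc (Suc i)) < length v" using assms by auto
  then obtain v' z t r where "v = v' @ z # t # r" "length v' = j - Suc (Suc i)"
    by (rule list_split_at2)
  with w u assms show ?thesis by (intro that[of u x y v' z t r]) simp_all
qed

lemma list_split_at3:
  assumes "Suc (Suc j) < length w"
  obtains u x y z v where "w = u @ x # y # z # v" "length u = j"
proof -
  obtain u x y v where w: "w = u @ x # y # v" and u: "length u = j"
    by (rule list_split_at2[of j w]) (use assms in auto)
  then obtain z v' where "v = z # v'" using assms by (cases v) auto
  with w u show ?thesis by (intro that[of u x y z v']) simp_all
qed

lemma swap_contract_far:
  assumes "length u = i"
  shows "swap_at i (u @ x # y # v @ z # t # r) = u @ y # x # v @ z # t # r"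
    and "contract_at i (u @ x # y # v @ z # t # r) = u @ lie_bracket x y # v @ z # t # r"
    and "swap_at (Suc (Suc (i + length v))) (u @ x # y # v @ z # t # r) = u @ x # y # v @ t # z # r"
    and "contract_at (Suc (Suc (i + length v))) (u @ x # y # v @ z # t # r)
      = u @ x # y # v @ lie_bracket z t # r"
  using assms swap_at_append[of "u @ x # y # v"] contract_at_append[of "u @ x # y # v"]
  by (auto simp: swap_at_append contract_at_append)

lemma swap_contract_braid:
  assumes "length u = j"
  shows "swap_at j (u @ x # y # z # v) = u @ y # x # z # v"
    and "contract_at j (u @ x # y # z # v) = u @ lie_bracket x y # z # v"
    and "swap_at (Suc j) (u @ x # y # z # v) = u @ x # z # y # v"
    and "contract_at (Suc j) (u @ x # y # z # v) = u @ x # lie_bracket y z # v"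
  using assms swap_at_append[of "u @ [x]"] contract_at_append[of "u @ [x]"]
  by (auto simp: swap_at_append contract_at_append)

section \<open>Multilinear functions on words of fixed length\<close>

text \<open>The length is fixed because the functions to which this applies are controlled on words
  of one length only.\<close>

definition multilinear :: "nat \<Rightarrow> ('a::complex_vector list \<Rightarrow> 'b::complex_vector) \<Rightarrow> bool" where
  "multilinear n Q \<longleftrightarrow> (\<forall>u w. Suc (length u + length w) = n \<longrightarrow> clinear (\<lambda>x. Q (u @ x # w)))"

lemma multilinearD:
  "multilinear n Q \<Longrightarrow> Suc (length u + length w) = n \<Longrightarrow> clinear (\<lambda>x. Q (u @ x # w))"
  by (simp add: multilinear_def)

lemma multilinear_zero: "multilinear n (\<lambda>_. 0)"
  by (simp add: multilinear_def clinear_iff)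

lemma multilinear_add: "multilinear n Q \<Longrightarrow> multilinear n R \<Longrightarrow> multilinear n (\<lambda>w. Q w + R w)"
  by (simp add: multilinear_def complex_vector_pair.linear_compose_add)

lemma multilinear_compose:
  "multilinear n Q \<Longrightarrow> clinear L \<Longrightarrow> multilinear n (\<lambda>w. L (Q w))"
  unfolding multilinear_def using clinear_compose[of _ L] by blast

lemma clinear_scaleC: "clinear (\<lambda>x. c *\<^sub>C x)"
  by (simp add: clinear_iff scaleC_add_right scaleC_scaleC mult.commute)

lemmas multilinear_scale = multilinear_compose[OF _ clinear_scaleC]

lemma multilinear_Cons:
  assumes "multilinear (Suc n) Q" shows "multilinear n (\<lambda>w. Q (x # w))"
proof (unfold multilinear_def, intro allI impI)
  fix u w :: "'a list" assume "Suc (length u + length w) = n"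
  then show "clinear (\<lambda>y. Q (x # u @ y # w))" using multilinearD[OF assms, of "x # u" w] by simp
qed

lemma word_multilinear_iff: "word_multilinear Q \<longleftrightarrow> (\<forall>n. multilinear n Q)"
  by (auto simp: word_multilinear_def multilinear_def)



text \<open>Locates the adjacent pair at \<open>j\<close>, \<open>Suc j\<close> of a word
  \<open>u @ x # w\<close> relative to the variable letter \<open>x\<close>: before it, ending in
  it, starting with it, or after it.\<close>

lemma position_cases:
  assumes "j < length u + length w"
  obtains (before) u1 a b u2 where "u = u1 @ a # b # u2" "length u1 = j"
  | (left) u1 a where "u = u1 @ [a]" "length u1 = j"
  | (right) b w' where "w = b # w'" "length u = j"
  | (after) w1 a b w2 where "w = w1 @ a # b # w2" "j = Suc (length u + length w1)"
proof -
  consider "Suc j < length u" | "Suc j = length u" | "j = length u" | "length u < j" by linarith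
  then show thesis
  proof cases
    case 1
    then show ?thesis by (rule list_split_at2) (rule before)
  next
    case 2
    then have "u = butlast u @ [last u]" "length (butlast u) = j"
      by (metis append_butlast_last_id list.size(3) nat.distinct(1)) (use 2 in simp)
    then show ?thesis by (rule left)
  next
    case 3
    then obtain b w' where "w = b # w'" using assms by (cases w) auto
    then show ?thesis using right 3 by blast
  next
    case 4
    then have "Suc (j - Suc (length u)) < length w" using assms by linarith
    then obtain w1 a b w2 where "w = w1 @ a # b # w2" "length w1 = j - Suc (length u)"
      by (rule list_split_at2)
    then show ?thesis using 4 by (intro after) auto
  qed
qed

lemma multilinear_swap:
  assumes Q: "multilinear n Q" and j: "Suc j < n"
  shows "multilinear n (\<lambda>w. Q (swap_at j w))"
proof (unfold multilinear_def, intro allI impI)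
  fix u w :: "'a list" assume n: "Suc (length u + length w) = n"
  with j have "j < length u + length w" by simp
  then show "clinear (\<lambda>x. Q (swap_at j (u @ x # w)))"
  proof (cases rule: position_cases)
    case (before u1 a b u2)
    then show ?thesis using multilinearD[OF Q, of "u1 @ b # a # u2" w] n
      by (simp add: swap_at_append)
  next
    case (left u1 a)
    then show ?thesis using multilinearD[OF Q, of u1 "a # w"] n by (simp add: swap_at_append)
  next
    case (right b w')
    then show ?thesis using multilinearD[OF Q, of "u @ [b]" w'] n by (simp add: swap_at_append)
  next
    case (after w1 a b w2)
    then have "swap_at j (u @ x # w) = u @ x # w1 @ b # a # w2" for x
      using swap_at_append[of "u @ x # w1" j] by simp
    then show ?thesis using multilinearD[OF Q, of u "w1 @ b # a # w2"] n after by simp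
  qed
qed

lemma clinear_lie_bracket_left: "clinear (\<lambda>x. lie_bracket x y)"
  by (simp add: clinear_iff lie_bracket_add_left lie_bracket_scaleC_left)

lemma clinear_lie_bracket_right: "clinear (lie_bracket x)"
  by (simp add: clinear_iff lie_bracket_add_right lie_bracket_scaleC_right)

lemma lie_bracket_skew: "lie_bracket x y = - lie_bracket y x"
proof -
  have "lie_bracket x x + lie_bracket y x + (lie_bracket x y + lie_bracket y y) = 0"
    using lie_bracket_self[of "x + y"] by (simp only: lie_bracket_add_left lie_bracket_add_right)
  then show ?thesis by (simp add: lie_bracket_self eq_neg_iff_add_eq_0 add.commute)
qed

text \<open>The Jacobi identity in the form needed twice below: for the braid relation and for the
  equivariance of contraction.\<close>

lemma lie_bracket_derivation:
  "lie_bracket (lie_bracket x y) z = lie_bracket (lie_bracket x z) y + lie_bracket x (lie_bracket y z)"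
proof -
  have "lie_bracket z (lie_bracket x y) = - lie_bracket (lie_bracket x y) z"
    "lie_bracket y (lie_bracket z x) = lie_bracket (lie_bracket x z) y"
    using lie_bracket_skew[of z x] lie_bracket_skew[of y "lie_bracket z x"]
      lie_bracket_skew[of z "lie_bracket x y"]
    by (simp_all add: clinear_neg[OF clinear_lie_bracket_left])
  with lie_bracket_jacobi[of x y z] show ?thesis by (simp add: algebra_simps)
qed

lemma multilinear_contract:
  assumes Q: "multilinear n Q" and j: "j < n"
  shows "multilinear (Suc n) (\<lambda>w. Q (contract_at j w))"
proof (unfold multilinear_def, intro allI impI)
  fix u w :: "'a list" assume n: "Suc (length u + length w) = Suc n"
  with j have "j < length u + length w" by simp
  then show "clinear (\<lambda>x. Q (contract_at j (u @ x # w)))"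
  proof (cases rule: position_cases)
    case (before u1 a b u2)
    then show ?thesis using multilinearD[OF Q, of "u1 @ lie_bracket a b # u2" w] n
      by (simp add: contract_at_append)
  next
    case (left u1 a)
    then show ?thesis
      using clinear_compose[OF clinear_lie_bracket_right multilinearD[OF Q, of u1 w]] n
      by (simp add: contract_at_append)
  next
    case (right b w')
    then show ?thesis
      using clinear_compose[OF clinear_lie_bracket_left multilinearD[OF Q, of u w']] n
      by (simp add: contract_at_append)
  next
    case (after w1 a b w2)
    then have "contract_at j (u @ x # w) = u @ x # w1 @ lie_bracket a b # w2" for x
      using contract_at_append[of "u @ x # w1" j] by simp
    then show ?thesis using multilinearD[OF Q, of u "w1 @ lie_bracket a b # w2"] n after by simp
  qed
qed

section \<open>The adjoint action on functions of words\<close>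

text \<open>The sum of the values of \<open>Q\<close> over all ways of replacing one letter
  \<open>x\<close> by \<open>lie_bracket x X\<close>. It is dual to the adjoint derivation of the
  tensor algebra, and acts on functions because a sum of words is not a word.\<close>

primrec der :: "'g::complex_lie_algebra \<Rightarrow> ('g list \<Rightarrow> 'w::complex_vector) \<Rightarrow> 'g list \<Rightarrow> 'w" where
  "der X Q [] = 0"
| "der X Q (x # w) = Q (lie_bracket x X # w) + der X (\<lambda>l. Q (x # l)) w"

lemma der_append: "der X Q (u @ w) = der X (\<lambda>l. Q (l @ w)) u + der X (\<lambda>l. Q (u @ l)) w"
  by (induction u arbitrary: Q) (simp_all add: add.assoc)

lemma der_cong:
  "(\<And>l. length l = length w \<Longrightarrow> Q l = R l) \<Longrightarrow> der X Q w = der X R w"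
proof (induction w arbitrary: Q R)
  case (Cons x w)
  have "der X (\<lambda>l. Q (x # l)) w = der X (\<lambda>l. R (x # l)) w" by (rule Cons.IH) (simp add: Cons.prems)
  then show ?case by (simp add: Cons.prems)
qed simp

lemma der_add: "der X (\<lambda>l. Q l + R l) w = der X Q w + der X R w"
  by (induction w arbitrary: Q R) simp_all

lemma der_compose: "clinear L \<Longrightarrow> der X (\<lambda>l. L (Q l)) w = L (der X Q w)"
  by (induction w arbitrary: Q) (simp_all add: clinear_0 clinear_add)

lemma der_zero: "der X (\<lambda>_. 0) w = 0"
  by (induction w) simp_all

lemma clinear_der:
  "(\<And>l. length l = length w \<Longrightarrow> clinear (Q l)) \<Longrightarrow> clinear (\<lambda>x. der X (\<lambda>l. Q l x) w)"
proof (induction w arbitrary: Q)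
  case (Cons y w)
  have "clinear (\<lambda>x. der X (\<lambda>l. Q (y # l) x) w)" by (rule Cons.IH) (simp add: Cons.prems)
  then show ?case by (simp add: Cons.prems complex_vector_pair.linear_compose_add)
qed (simp add: clinear_iff)

lemma multilinear_der:
  assumes Q: "multilinear n Q" shows "multilinear n (der X Q)"
proof (unfold multilinear_def, intro allI impI)
  fix u w :: "'a list" assume n: "Suc (length u + length w) = n"
  have "clinear (\<lambda>x. der X (\<lambda>l. Q (l @ x # w)) u)"
    by (rule clinear_der) (use multilinearD[OF Q] n in simp)
  moreover have "clinear (\<lambda>x. der X (\<lambda>l. Q (u @ x # l)) w)"
    by (rule clinear_der) (use multilinearD[OF Q] n in simp)
  moreover have "clinear (\<lambda>x. Q (u @ lie_bracket x X # w))"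
    by (rule clinear_compose[OF clinear_lie_bracket_left multilinearD[OF Q]]) (use n in simp)
  ultimately show "clinear (\<lambda>x. der X Q (u @ x # w))"
    by (simp add: der_append complex_vector_pair.linear_compose_add)
qed

lemma der_swap:
  assumes "Suc j < length w"
  shows "der X (\<lambda>l. Q (swap_at j l)) w = der X Q (swap_at j w)"
proof -
  obtain u x y v where w: "w = u @ x # y # v" "length u = j" by (rule list_split_at2[OF assms])
  \<comment> \<open>\<open>der\<close> only evaluates at prefixes of the same length as
    \<open>u\<close>, so the exchanged pair still starts at position \<open>j\<close>.\<close>
  have 1: "der X (\<lambda>l. Q (swap_at j (l @ x # y # v))) u = der X (\<lambda>l. Q (l @ y # x # v)) u"
    by (rule der_cong) (simp add: swap_at_append w)
  from w show ?thesis by (simp add: der_append 1 swap_at_append algebra_simps)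
qed

text \<open>Contraction is equivariant: differentiating the contracted letter gives two terms by the
  Jacobi identity, one for each of the letters bracketed.\<close>

lemma der_contract:
  assumes "Suc j < length w" and Q: "multilinear n Q" "length w = Suc n"
  shows "der X (\<lambda>l. Q (contract_at j l)) w = der X Q (contract_at j w)"
proof -
  obtain u x y v where w: "w = u @ x # y # v" "length u = j"
    by (rule list_split_at2[OF assms(1)])
  have 1: "der X (\<lambda>l. Q (contract_at j (l @ x # y # v))) u = der X (\<lambda>l. Q (l @ lie_bracket x y # v)) u"
    by (rule der_cong) (simp add: contract_at_append w)
  have "clinear (\<lambda>x. Q (u @ x # v))" using multilinearD[OF Q(1), of u v] Q(2) w by simp
  then have 2: "Q (u @ lie_bracket (lie_bracket x y) X # v)
      = Q (u @ lie_bracket (lie_bracket x X) y # v) + Q (u @ lie_bracket x (lie_bracket y X) # v)"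
    by (subst lie_bracket_derivation) (rule clinear_add)
  from w show ?thesis by (simp add: der_append 1 2 contract_at_append algebra_simps)
qed


section \<open>The projection of the enveloping algebra onto the Lie algebra\<close>

text \<open>The restriction of \<pi> to words of length \<open>n\<close>. The induced map on U(g) is
  known as the first Eulerian idempotent, the projection onto the degree one part under
  symmetrisation.\<close>

fun eul :: "nat \<Rightarrow> 'g::complex_lie_algebra list \<Rightarrow> 'g" where
  "eul 0 = (\<lambda>_. 0)"
| "eul (Suc 0) = hd"
| "eul (Suc (Suc n)) =
    primitive swap_at (\<lambda>j w. eul (Suc n) (contract_at j w)) (Suc (Suc n)) (Suc (Suc n))"

text \<open>Skew symmetry of the bracket gives the involutive condition. For distant pairs both
  differences equal \<open>f'\<close> at the word with both pairs contracted. For the braid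
  relation, \<open>rel'\<close> turns the differences into \<open>f'\<close> at nested brackets,
  which cancel by the Jacobi identity.\<close>

lemma adjacent_cocycle_contract:
  fixes f f' :: "'g::complex_lie_algebra list \<Rightarrow> 'w::complex_vector"
  assumes f: "multilinear (Suc n) f" and f': "multilinear n f'"
    and rel: "\<And>w j. length w = Suc n \<Longrightarrow> j < n \<Longrightarrow> f w - f (swap_at j w) = f' (contract_at j w)"
  shows "adjacent_cocycle (Suc (Suc n)) {w. length w = Suc (Suc n)} swap_at
    (\<lambda>j w. f (contract_at j w))"
proof -
  have rel': "f (u @ x # y # v) = f (u @ y # x # v) + f' (u @ lie_bracket x y # v)"
    if "Suc (length u + length v) = n" for u v x y
    using rel[of "u @ x # y # v" "length u"] that
    by (simp add: swap_at_append contract_at_append algebra_simps)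
  show ?thesis
  proof (unfold_locales, unfold mem_Collect_eq)
    fix w :: "'g list" and j
    assume w: "length w = Suc (Suc n)" and "Suc j < Suc (Suc n)"
    then have "Suc j < length w" by simp
    then obtain u x y v where uv: "w = u @ x # y # v" "length u = j" by (rule list_split_at2)
    show "length (swap_at j w) = Suc (Suc n)" using w uv by (simp add: swap_at_append)
    show "swap_at j (swap_at j w) = w" using uv by (simp add: swap_at_append)
    have "clinear (\<lambda>x. f (u @ x # v))" using multilinearD[OF f, of u v] uv w by simp
    then show "f (contract_at j (swap_at j w)) = - f (contract_at j w)"
      using uv by (simp add: swap_at_append contract_at_append lie_bracket_skew[of y x])
        (erule clinear_neg)
  next
    fix w :: "'g list" and i j
    assume w: "length w = Suc (Suc n)" and "Suc i < j" "Suc j < Suc (Suc n)"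
    then have "Suc i < j" "Suc j < length w" by simp_all
    then obtain u x y v z t r where uv: "w = u @ x # y # v @ z # t # r" "length u = i"
      "j = Suc (Suc (i + length v))" by (rule list_split_far)
    show "swap_at i (swap_at j w) = swap_at j (swap_at i w)"
      by (simp add: uv swap_contract_far)
    show "f (contract_at i w) + f (contract_at j (swap_at i w))
        = f (contract_at j w) + f (contract_at i (swap_at j w))"
      using rel'[of "u @ lie_bracket x y # v" r z t] rel'[of u "v @ lie_bracket z t # r" x y] w
      by (simp add: uv swap_contract_far)
  next
    fix w :: "'g list" and j
    assume w: "length w = Suc (Suc n)" and "Suc (Suc j) < Suc (Suc n)"
    then have "Suc (Suc j) < length w" by simp
    then obtain u x y z v where uv: "w = u @ x # y # z # v" "length u = j" by (rule list_split_at3)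
    show "swap_at j (swap_at (Suc j) (swap_at j w))
        = swap_at (Suc j) (swap_at j (swap_at (Suc j) w))"
      using uv by (simp add: swap_contract_braid)
    have "clinear (\<lambda>x. f' (u @ x # v))" using multilinearD[OF f', of u v] uv w by simp
    then have "f' (u @ lie_bracket (lie_bracket x y) z # v)
        = f' (u @ lie_bracket (lie_bracket x z) y # v) + f' (u @ lie_bracket x (lie_bracket y z) # v)"
      by (subst lie_bracket_derivation) (rule clinear_add)
    moreover have "Suc (length u + length v) = n" using uv w by simp
    ultimately show "f (contract_at j w) + f (contract_at (Suc j) (swap_at j w))
          + f (contract_at j (swap_at (Suc j) (swap_at j w)))
        = f (contract_at (Suc j) w) + f (contract_at j (swap_at (Suc j) w))
          + f (contract_at (Suc j) (swap_at j (swap_at (Suc j) w)))"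
      using rel'[of u v "lie_bracket x y" z] rel'[of u v "lie_bracket x z" y]
        rel'[of u v x "lie_bracket y z"]
      by (simp add: uv swap_contract_braid algebra_simps)
  qed
qed

definition equivariant :: "nat \<Rightarrow> ('g::complex_lie_algebra list \<Rightarrow> 'g) \<Rightarrow> bool" where
  "equivariant n Q \<longleftrightarrow> (\<forall>w X. length w = n \<longrightarrow> der X Q w = lie_bracket (Q w) X)"

text \<open>Both properties hold for the contraction cocycle by the case of shorter words and
  survive averaging. They are proved together because equivariance of the cocycle uses
  multilinearity of the shorter projection.\<close>

lemma eul_multilinear_equivariant:
  "multilinear n (eul n :: 'g::complex_lie_algebra list \<Rightarrow> 'g) \<and>
    equivariant n (eul n :: 'g list \<Rightarrow> 'g)"
proof (induction n rule: induct_nat_012)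
  case 0
  show ?case
    by (auto simp: multilinear_def equivariant_def clinear_0[OF clinear_lie_bracket_left])
next
  case 1
  have "der X hd w = lie_bracket (hd w) X" if "length w = Suc 0" for w :: "'g list" and X
    using that by (cases w) auto
  then show ?case
    by (auto simp: multilinear_def equivariant_def clinear_iff)
next
  case (ge2 n)
  let ?n = "Suc (Suc n)"
  have "multilinear ?n Q \<and> equivariant ?n Q"
    if "Q = primitive swap_at (\<lambda>j w. eul (Suc n) (contract_at j w)) ?n ?n" for Q :: "'g list \<Rightarrow> 'g"
    unfolding that using order_refl[of ?n]
  proof (induction rule: primitive_closure)
    case (swap Q j)
    then show ?case
      by (auto simp: equivariant_def multilinear_swap der_swap length_swap_at)
  next
    case (cocycle j)
    then have "multilinear ?n (\<lambda>w. eul (Suc n) (contract_at j w :: 'g list))"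
      using ge2 by (intro multilinear_contract) auto
    moreover have "der X (\<lambda>l. eul (Suc n) (contract_at j l)) w
        = lie_bracket (eul (Suc n) (contract_at j w)) X" if "length w = ?n" for w :: "'g list" and X
    proof -
      have "length (contract_at j w) = Suc n"
        using length_contract_at[of j w] that cocycle by simp
      then show ?thesis
        using ge2 cocycle that der_contract[of j w "Suc n" "eul (Suc n)"]
        by (simp add: equivariant_def del: eul.simps)
    qed
    ultimately show ?case by (simp add: equivariant_def del: eul.simps)
  next
    case zero
    then show ?case
      by (simp add: multilinear_zero equivariant_def der_zero clinear_0[OF clinear_lie_bracket_left])
  next
    case (add Q R)
    then show ?case by (simp add: multilinear_add equivariant_def der_add lie_bracket_add_left)
  next
    case (scale Q c)
    then show ?case
      by (simp add: multilinear_scale equivariant_def der_compose[OF clinear_scaleC]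
          lie_bracket_scaleC_left)
  qed
  then show ?case by simp
qed

text \<open>The relation for one length is exactly what makes the next contraction a cocycle, so the
  induction runs along the recursion of \<open>eul\<close>. With \<open>l = n\<close>,
  \<open>primitive_swap\<close> covers all positions.\<close>

lemma eul_swap:
  "length w = Suc n \<Longrightarrow> j < n \<Longrightarrow> eul (Suc n) w - eul (Suc n) (swap_at j w) = eul n (contract_at j w)"
proof (induction n arbitrary: w j)
  case (Suc n)
  interpret adjacent_cocycle "Suc (Suc n)" "{w :: 'a list. length w = Suc (Suc n)}" swap_at
    "\<lambda>j w. eul (Suc n) (contract_at j w)"
    by (rule adjacent_cocycle_contract[where f' = "eul n"])
      (use eul_multilinear_equivariant Suc.IH in blast)+
  show ?case
    using primitive_swap[of "Suc (Suc n)" w j] Suc.prems by (simp del: primitive.simps)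
qed simp

lemma adjacent_cocycle_eul:
  "adjacent_cocycle (Suc (Suc n)) {w :: 'g::complex_lie_algebra list. length w = Suc (Suc n)} swap_at
    (\<lambda>j w. eul (Suc n) (contract_at j w))"
  by (rule adjacent_cocycle_contract[where f' = "eul n"])
    (use eul_multilinear_equivariant eul_swap in blast)+

definition word_proj :: "'g::complex_lie_algebra list \<Rightarrow> 'g" where
  "word_proj w = eul (length w) w"

lemma multilinear_length_cong:
  "multilinear n Q \<Longrightarrow> (\<And>w. length w = n \<Longrightarrow> Q w = R w) \<Longrightarrow> multilinear n R"
  by (simp add: multilinear_def)

lemma multilinear_word_proj: "multilinear n word_proj"
  by (rule multilinear_length_cong[of n "eul n"])
    (simp_all add: eul_multilinear_equivariant word_proj_def)

lemma der_word_proj: "der X word_proj w = lie_bracket (word_proj w) X"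
proof -
  have "der X word_proj w = der X (eul (length w)) w"
    by (rule der_cong) (simp add: word_proj_def)
  then show ?thesis
    using eul_multilinear_equivariant[of "length w", where 'g = 'a]
    by (simp add: equivariant_def word_proj_def)
qed

text \<open>This makes \<pi> well defined on U(g): the defining relation of U(g) at position
  \<open>length u\<close> is \<open>eul_swap\<close>.\<close>

lemma word_proj_compatible: "word_lie_compatible word_proj"
proof (unfold word_lie_compatible_def, intro conjI allI)
  show "word_multilinear word_proj"
    by (simp add: word_multilinear_iff multilinear_word_proj)
  fix u w :: "'a list" and X Y
  show "word_proj (u @ [X, Y] @ w) - word_proj (u @ [Y, X] @ w) = word_proj (u @ [lie_bracket X Y] @ w)"
    using eul_swap[of "u @ X # Y # w" "Suc (length u + length w)" "length u"]
    by (simp add: word_proj_def swap_at_append contract_at_append del: eul.simps)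
qed


section \<open>Functoriality of tensor products\<close>

lemma clinear_eq_on_tensors:
  fixes F G :: "('a::complex_vector, 'b::complex_vector) tensor \<Rightarrow> 'c::complex_vector"
  assumes "clinear F" "clinear G" "\<And>a b. F (a \<otimes> b) = G (a \<otimes> b)"
  shows "F t = G t"
  by (induction t rule: tensor_induct) (simp_all add: assms clinear_add)

lemma tensor_map_compose:
  assumes "clinear f" "clinear g" "clinear f'" "clinear g'"
  shows "tensor_map f' g' (tensor_map f g t) = tensor_map (\<lambda>a. f' (f a)) (\<lambda>b. g' (g b)) t"
  by (rule clinear_eq_on_tensors)
    (simp_all add: assms clinear_tensor_map clinear_compose[OF clinear_tensor_map clinear_tensor_map]
      clinear_compose tensor_map_tensor)

lemma clinear_ident: "clinear (\<lambda>a. a)"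
  by (simp add: clinear_iff)

lemma tensor_map_id: "tensor_map (\<lambda>a. a) (\<lambda>b. b) t = t"
  by (rule clinear_eq_on_tensors) (simp_all add: clinear_ident clinear_tensor_map tensor_map_tensor)

section \<open>Iterated coactions\<close>

text \<open>\<open>eval_iter nab k Q v\<close> is \<open>Q(v\<^sub>[\<^sub>-\<^sub>k\<^sub>], \<dots>, v\<^sub>[\<^sub>-\<^sub>1\<^sub>]) \<otimes> v\<^sub>[\<^sub>0\<^sub>]\<close>. It is meaningful only for \<open>Q\<close> multilinear
  on words of length \<open>k\<close>.\<close>

primrec eval_iter ::
    "('v::complex_vector \<Rightarrow> ('g::complex_lie_algebra, 'v) tensor) \<Rightarrow> nat
      \<Rightarrow> ('g list \<Rightarrow> 'w::complex_vector) \<Rightarrow> 'v \<Rightarrow> ('w, 'v) tensor" where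
  "eval_iter nab 0 = (\<lambda>Q v. Q [] \<otimes> v)"
| "eval_iter nab (Suc k) =
    (\<lambda>Q v. tensor_lift (\<lambda>X w. eval_iter nab k (\<lambda>l. Q (X # l)) w) (nab v))"

lemma eval_iter_add:
  fixes Q R :: "'g::complex_lie_algebra list \<Rightarrow> 'w::complex_vector"
  shows "eval_iter nab k (\<lambda>l. Q l + R l) v = eval_iter nab k Q v + eval_iter nab k R v"
proof (induction k arbitrary: Q R v)
  case (Suc k)
  have "eval_iter nab k (\<lambda>l. Q l + R l) = (\<lambda>v. eval_iter nab k Q v + eval_iter nab k R v)"
    for Q R :: "'g list \<Rightarrow> 'w"
    by (rule ext) (rule Suc.IH)
  then show ?case by (simp add: tensor_lift_fun_add)
qed (simp add: tensor_add_left)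

lemma eval_iter_scale:
  fixes Q :: "'g::complex_lie_algebra list \<Rightarrow> 'w::complex_vector"
  shows "eval_iter nab k (\<lambda>l. c *\<^sub>C Q l) v = c *\<^sub>C eval_iter nab k Q v"
proof (induction k arbitrary: Q v)
  case (Suc k)
  have "eval_iter nab k (\<lambda>l. c *\<^sub>C Q l) = (\<lambda>v. c *\<^sub>C eval_iter nab k Q v)"
    for Q :: "'g list \<Rightarrow> 'w"
    by (rule ext) (rule Suc.IH)
  then show ?case by (simp add: tensor_lift_fun_scale)
qed (simp add: tensor_scale_left)

lemma eval_iter_zero: "eval_iter nab k (\<lambda>l. 0) v = 0"
  using eval_iter_scale[of nab k 0 "\<lambda>_. 0" v] by simp

lemma eval_iter_cong:
  "(\<And>l. length l = k \<Longrightarrow> Q l = R l) \<Longrightarrow> eval_iter nab k Q v = eval_iter nab k R v"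
proof (induction k arbitrary: Q R v)
  case (Suc k)
  have "eval_iter nab k (\<lambda>l. Q (X # l)) = eval_iter nab k (\<lambda>l. R (X # l))" for X
    by (rule ext, rule Suc.IH) (simp add: Suc.prems)
  then show ?case by simp
qed simp

context
  fixes nab :: "'v::complex_vector \<Rightarrow> ('g::complex_lie_algebra, 'v) tensor"
  assumes nab: "clinear nab"
begin

text \<open>Linearity in the letter comes from \<open>Q\<close>; linearity in the vector is a
  hypothesis, supplied by the induction in \<open>clinear_eval_iter\<close>.\<close>

lemma cbilinear_eval_iter_step:
  assumes Q: "multilinear (Suc k) Q"
    and lin: "\<And>X. clinear (eval_iter nab k (\<lambda>l. Q (X # l)))"
  shows "cbilinear (\<lambda>X. eval_iter nab k (\<lambda>l. Q (X # l)))"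
proof -
  have Q': "clinear (\<lambda>X. Q (X # l))" if "length l = k" for l
    using multilinearD[OF Q, of "[]" l] that by simp
  show ?thesis
  proof (rule cbilinearI)
    fix X Y w
    show "eval_iter nab k (\<lambda>l. Q ((X + Y) # l)) w
        = eval_iter nab k (\<lambda>l. Q (X # l)) w + eval_iter nab k (\<lambda>l. Q (Y # l)) w"
      unfolding eval_iter_add[symmetric] by (rule eval_iter_cong) (rule clinear_add[OF Q'])
  next
    fix c X w
    show "eval_iter nab k (\<lambda>l. Q ((c *\<^sub>C X) # l)) w = c *\<^sub>C eval_iter nab k (\<lambda>l. Q (X # l)) w"
      unfolding eval_iter_scale[symmetric] by (rule eval_iter_cong) (rule clinear_scale[OF Q'])
  qed (simp_all add: clinear_add[OF lin] clinear_scale[OF lin])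
qed

lemma clinear_eval_iter: "multilinear k Q \<Longrightarrow> clinear (eval_iter nab k Q)"
proof (induction k arbitrary: Q)
  case 0
  show ?case by (simp add: clinear_iff tensor_add_right tensor_scale_right)
next
  case (Suc k)
  note bil = cbilinear_eval_iter_step[OF Suc.prems Suc.IH[OF multilinear_Cons[OF Suc.prems]]]
  show ?case using clinear_compose[OF nab clinear_tensor_lift[OF bil]] by simp
qed

lemma cbilinear_eval_iter:
  "multilinear (Suc k) Q \<Longrightarrow> cbilinear (\<lambda>X. eval_iter nab k (\<lambda>l. Q (X # l)))"
  by (intro cbilinear_eval_iter_step clinear_eval_iter multilinear_Cons)

lemma eval_iter_compose:
  assumes L: "clinear L"
  shows "multilinear k Q \<Longrightarrow> eval_iter nab k (\<lambda>l. L (Q l)) v = tensor_map L id (eval_iter nab k Q v)"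
proof (induction k arbitrary: Q v)
  case 0
  show ?case by (simp add: tensor_map_tensor L clinear_ident id_def)
next
  case (Suc k)
  note bil = cbilinear_eval_iter[OF Suc.prems]
  note bil' = cbilinear_eval_iter[OF multilinear_compose[OF Suc.prems L]]
  have "tensor_lift (\<lambda>X. eval_iter nab k (\<lambda>l. L (Q (X # l)))) t
      = tensor_map L id (tensor_lift (\<lambda>X. eval_iter nab k (\<lambda>l. Q (X # l))) t)" for t
    by (rule clinear_eq_on_tensors[OF clinear_tensor_lift[OF bil']
          clinear_compose[OF clinear_tensor_lift[OF bil] clinear_tensor_map[OF L clinear_id]]])
      (simp only: tensor_lift_tensor[OF bil] tensor_lift_tensor[OF bil']
        Suc.IH[OF multilinear_Cons[OF Suc.prems]])
  then show ?case by (simp only: eval_iter.simps)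
qed

lemma multilinear_ta_word: "multilinear k (\<lambda>l. prod_list (map ta_gen l))"
  by (simp add: multilinear_def clinear_iff distrib_left distrib_right scaleC_mult_left
      scaleC_mult_right clinear_add[OF clinear_ta_gen] clinear_scale[OF clinear_ta_gen])

text \<open>The bridge between the iterates in the tensor algebra and evaluation on words. The
  induction generalises \<open>L\<close>, since the leftmost letter is absorbed into it.\<close>

lemma tensor_map_coact_iter:
  assumes "clinear L"
  shows "tensor_map L id (coact_iter nab k v) = eval_iter nab k (\<lambda>l. L (prod_list (map ta_gen l))) v"
  using assms
proof (induction k arbitrary: L v)
  case 0
  then show ?case by (simp add: tensor_map_tensor clinear_ident id_def)
next
  case (Suc k)
  note L = Suc.prems
  note bil = cbilinear_coact_iter_step[OF clinear_coact_iter[OF nab]]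
  note bil' = cbilinear_eval_iter[OF multilinear_compose[OF multilinear_ta_word L]]
  have L': "clinear (\<lambda>t. L (ta_gen X * t))" for X
    by (rule clinear_compose[OF clinear_ta_gen_mult L])
  have "tensor_map L id (tensor_lift (\<lambda>X w. tensor_map (\<lambda>t. ta_gen X * t) id (coact_iter nab k w)) t)
      = tensor_lift (\<lambda>X. eval_iter nab k (\<lambda>l. L (prod_list (map ta_gen (X # l))))) t" for t
    by (rule clinear_eq_on_tensors[OF clinear_compose[OF clinear_tensor_lift[OF bil]
            clinear_tensor_map[OF L clinear_id]] clinear_tensor_lift[OF bil']],
        unfold tensor_lift_tensor[OF bil] tensor_lift_tensor[OF bil']
        tensor_map_compose[OF clinear_ta_gen_mult clinear_id L clinear_id])
      (use Suc.IH[OF L'] in \<open>simp add: id_def\<close>)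
  then show ?case by (simp only: eval_iter.simps coact_iter.simps)
qed

end

text \<open>Peel off the leftmost letter: the bracket term of the AYD condition is the head summand
  of \<open>der\<close>, and the action term passes to the remaining coactions. An empty word has no
  letter to bracket, so only the action remains.\<close>

lemma eval_iter_act:
  assumes nab: "clinear nab" and act: "cbilinear act" and ayd: "AYD_lie act nab"
  shows "multilinear k Q \<Longrightarrow> eval_iter nab k Q (act v X)
    = tensor_map id (\<lambda>w. act w X) (eval_iter nab k Q v) + eval_iter nab k (der X Q) v"
proof (induction k arbitrary: Q v)
  case 0
  have "clinear (\<lambda>w. act w X)" using act by (simp add: cbilinear_def)
  moreover have "(0::'c) \<otimes> v = 0" using tensor_scale_left[of 0 "0::'c" v] by simp
  ultimately show ?case by (simp add: tensor_map_tensor clinear_ident id_def)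
next
  case (Suc k)
  have actX: "clinear (\<lambda>w. act w X)" using act by (simp add: cbilinear_def)
  let ?F = "\<lambda>R. tensor_lift (\<lambda>Y. eval_iter nab k (\<lambda>l. R (Y # l)))"
  note bil = cbilinear_eval_iter[OF nab Suc.prems]
  note bil' = cbilinear_eval_iter[OF nab multilinear_der[OF Suc.prems]]
  note F = clinear_tensor_lift[OF bil] and F' = clinear_tensor_lift[OF bil']
  have lin: "clinear (\<lambda>t. ?F Q (tensor_map id (\<lambda>w. act w X) t + tensor_map (\<lambda>Y. lie_bracket Y X) id t))"
    by (intro clinear_compose[OF _ F] complex_vector_pair.linear_compose_add clinear_tensor_map
        clinear_id actX clinear_lie_bracket_left)
  have lin': "clinear (\<lambda>t. tensor_map id (\<lambda>w. act w X) (?F Q t) + ?F (der X Q) t)"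
    by (intro complex_vector_pair.linear_compose_add clinear_compose[OF F] F' clinear_tensor_map
        clinear_id actX)
  have "?F Q (tensor_map id (\<lambda>w. act w X) t + tensor_map (\<lambda>Y. lie_bracket Y X) id t)
      = tensor_map id (\<lambda>w. act w X) (?F Q t) + ?F (der X Q) t" for t
    by (rule clinear_eq_on_tensors[OF lin lin'])
      (simp only: tensor_map_tensor[OF clinear_id actX] clinear_add[OF F]
        tensor_map_tensor[OF clinear_lie_bracket_left clinear_id]
        tensor_lift_tensor[OF bil] tensor_lift_tensor[OF bil'],
        simp add: Suc.IH[OF multilinear_Cons[OF Suc.prems]] eval_iter_add id_def add_ac)
  moreover have "nab (act v X)
      = tensor_map id (\<lambda>w. act w X) (nab v) + tensor_map (\<lambda>Y. lie_bracket Y X) id (nab v)"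
    using ayd by (simp only: AYD_lie_def)
  ultimately show ?case by (simp only: eval_iter.simps)
qed


section \<open>Symmetry of the iterated coactions\<close>

context
  fixes A :: "'a::complex_vector \<Rightarrow> 'a \<Rightarrow> 'b::complex_vector"
  assumes A: "cbilinear A" and alternating: "\<And>X. A X X = 0"
begin

text \<open>An alternating bilinear map kills every \<open>X \<otimes> X\<close>, hence it factors
  through the exterior square and any representative gives its value.\<close>

lemma tensor_lift_rep_ext2: "tensor_lift A (rep_ext2 (abs_ext2 t)) = tensor_lift A t"
proof -
  note lin = clinear_tensor_lift[OF A]
  have "abs_ext2 (rep_ext2 (abs_ext2 t)) = abs_ext2 t"
    by (rule Quotient3_abs_rep[OF Quotient3_ext2])
  then have "rep_ext2 (abs_ext2 t) - t \<in> complex_vector.span {X \<otimes> X |X. True}"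
    by (simp only: ext2.abs_eq_iff)
  then have "tensor_lift A (rep_ext2 (abs_ext2 t) - t) = 0"
    by (rule clinear_eq_0_on_span[OF lin, rotated]) (auto simp: tensor_lift_tensor[OF A] alternating)
  then show ?thesis by (simp add: clinear_diff[OF lin])
qed

lemma clinear_wedge_lift: "clinear (\<lambda>e. tensor_lift A (rep_ext2 e))"
proof (rule clinearI)
  note lin = clinear_tensor_lift[OF A]
  fix x y :: "'a ext2" and c
  obtain s t where st: "x = abs_ext2 s" "y = abs_ext2 t"
    by (metis Quotient3_abs_rep[OF Quotient3_ext2])
  show "tensor_lift A (rep_ext2 (x + y)) = tensor_lift A (rep_ext2 x) + tensor_lift A (rep_ext2 y)"
    by (simp add: st plus_ext2.abs_eq tensor_lift_rep_ext2 clinear_add[OF lin])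
  show "tensor_lift A (rep_ext2 (c *\<^sub>C x)) = c *\<^sub>C tensor_lift A (rep_ext2 x)"
    by (simp add: st scaleC_ext2.abs_eq tensor_lift_rep_ext2 clinear_scale[OF lin])
qed

lemma wedge_lift_wedge: "tensor_lift A (rep_ext2 (X \<and>\<^sub>2 Y)) = A X Y"
  by (simp add: wedge.abs_eq tensor_lift_rep_ext2 tensor_lift_tensor[OF A])

end

lemma tensor_lift_zero: "tensor_lift (\<lambda>a b. 0) t = 0"
  using tensor_lift_fun_scale[of 0 "\<lambda>_ _. 0" t] by simp

lemma clinear_wedge: "clinear (\<lambda>Y. X \<and>\<^sub>2 Y)"
  by (rule cbilinear_wedge[unfolded cbilinear_def, THEN conjunct1, THEN spec])

text \<open>The evaluation factors through the wedge of the two leading letters of the iterated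
  coaction of \<open>v\<close>, which is zero by the comodule condition.\<close>

lemma eval_iter_alternating_head:
  fixes Q :: "'g::complex_lie_algebra list \<Rightarrow> 'w::complex_vector"
  assumes com: "left_lie_comodule nab" and Q: "multilinear (Suc (Suc k)) Q"
    and alt: "\<And>x w. length w = k \<Longrightarrow> Q (x # x # w) = 0"
  shows "eval_iter nab (Suc (Suc k)) Q v = 0"
proof -
  have nab: "clinear nab" using com by (simp add: left_lie_comodule_def)
  define A where "A w X Y = eval_iter nab k (\<lambda>l. Q (X # Y # l)) w" for w X Y
  have Q1: "multilinear (Suc k) (\<lambda>l. Q (X # l))" for X by (rule multilinear_Cons[OF Q])
  have lin_w: "clinear (eval_iter nab k (\<lambda>l. Q (X # Y # l)))" for X Y
    by (rule clinear_eval_iter[OF nab multilinear_Cons[OF Q1]])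
  have bilY: "cbilinear (\<lambda>Y w. A w X Y)" for X
    unfolding A_def by (rule cbilinear_eval_iter[OF nab Q1])
  have linX: "clinear (\<lambda>X. Q (X # Y # l))" if "length l = k" for Y l
    using multilinearD[OF Q, of "[]" "Y # l"] that by simp
  have bilA: "cbilinear (A w)" for w
  proof (unfold cbilinear_def, intro conjI allI)
    show "clinear (A w X)" for X using bilY by (simp add: cbilinear_def)
    show "clinear (\<lambda>X. A w X Y)" for Y
    proof (rule clinearI)
      show "A w (X + X') Y = A w X Y + A w X' Y" for X X'
        unfolding A_def eval_iter_add[symmetric] by (rule eval_iter_cong) (rule clinear_add[OF linX])
      show "A w (c *\<^sub>C X) Y = c *\<^sub>C A w X Y" for c X
        unfolding A_def eval_iter_scale[symmetric] by (rule eval_iter_cong) (rule clinear_scale[OF linX])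
    qed
  qed
  have altA: "A w X X = 0" for w X
    unfolding A_def by (subst eval_iter_zero[symmetric, of nab k w]) (rule eval_iter_cong, rule alt)
  \<comment> \<open>\<open>A w\<close> is alternating, so it descends to the exterior square;
    \<open>h\<close> is the descended map, with the trailing vector as a second argument.\<close>
  define h where "h e w = tensor_lift (A w) (rep_ext2 e)" for e w
  have bilh: "cbilinear h"
  proof (unfold cbilinear_def, intro conjI allI)
    show "clinear (\<lambda>e. h e w)" for w unfolding h_def by (rule clinear_wedge_lift[OF bilA altA])
    have A_add: "A (w + w') = (\<lambda>X Y. A w X Y + A w' X Y)" for w w'
      by (intro ext) (simp add: A_def clinear_add[OF lin_w])
    have A_scale: "A (c *\<^sub>C w) = (\<lambda>X Y. c *\<^sub>C A w X Y)" for c w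
      by (intro ext) (simp add: A_def clinear_scale[OF lin_w])
    show "clinear (h e)" for e
      by (rule clinearI) (simp_all only: h_def A_add A_scale tensor_lift_fun_add tensor_lift_fun_scale)
  qed
  have h_wedge: "h (X \<and>\<^sub>2 Y) w = A w X Y" for X Y w
    unfolding h_def by (rule wedge_lift_wedge[OF bilA altA])
  have bilT: "cbilinear (\<lambda>X :: 'g. tensor_map (\<lambda>Y. X \<and>\<^sub>2 Y) (id :: 'a \<Rightarrow> 'a))"
  proof (rule cbilinearI)
    note bw = cbilinear_wedge[unfolded cbilinear_iff]
    fix X X' :: 'g and s :: "('g, 'a) tensor" and c
    show "tensor_map (\<lambda>Y. (X + X') \<and>\<^sub>2 Y) id s
        = tensor_map (\<lambda>Y. X \<and>\<^sub>2 Y) id s + tensor_map (\<lambda>Y. X' \<and>\<^sub>2 Y) id s"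
      unfolding tensor_map_fun_add_left[symmetric] by (simp add: bw)
    show "tensor_map (\<lambda>Y. (c *\<^sub>C X) \<and>\<^sub>2 Y) id s = c *\<^sub>C tensor_map (\<lambda>Y. X \<and>\<^sub>2 Y) id s"
      unfolding tensor_map_fun_scale_left[symmetric] by (simp add: bw)
  qed (rule clinear_add[OF clinear_tensor_map[OF clinear_wedge clinear_id]]
      clinear_scale[OF clinear_tensor_map[OF clinear_wedge clinear_id]])+
  have inner: "tensor_lift h (tensor_map (\<lambda>Y. X \<and>\<^sub>2 Y) id s) = tensor_lift (\<lambda>Y w. A w X Y) s" for X s
    by (rule clinear_eq_on_tensors[OF clinear_compose[OF clinear_tensor_map[OF clinear_wedge clinear_id]
            clinear_tensor_lift[OF bilh]] clinear_tensor_lift[OF bilY]])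
      (simp only: tensor_map_tensor[OF clinear_wedge clinear_id] tensor_lift_tensor[OF bilh]
        tensor_lift_tensor[OF bilY] h_wedge id_apply)
  note bilE = cbilinear_eval_iter[OF nab Q]
  have "tensor_lift h (tensor_lift (\<lambda>X. tensor_map (\<lambda>Y. X \<and>\<^sub>2 Y) id) (tensor_map id nab t))
      = tensor_lift (\<lambda>X. eval_iter nab (Suc k) (\<lambda>l. Q (X # l))) t" for t
  proof (rule clinear_eq_on_tensors[OF clinear_compose[OF clinear_tensor_map[OF clinear_id nab]
            clinear_compose[OF clinear_tensor_lift[OF bilT] clinear_tensor_lift[OF bilh]]]
          clinear_tensor_lift[OF bilE]])
    fix X w
    show "tensor_lift h (tensor_lift (\<lambda>X. tensor_map (\<lambda>Y. X \<and>\<^sub>2 Y) id) (tensor_map id nab (X \<otimes> w)))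
        = tensor_lift (\<lambda>X. eval_iter nab (Suc k) (\<lambda>l. Q (X # l))) (X \<otimes> w)"
      by (simp only: tensor_map_tensor[OF clinear_id nab] tensor_lift_tensor[OF bilT] inner
          tensor_lift_tensor[OF bilE], simp only: eval_iter.simps id_apply A_def)
  qed
  moreover have "tensor_lift (\<lambda>X. tensor_map (\<lambda>Y. X \<and>\<^sub>2 Y) id) (tensor_map id nab (nab v)) = 0"
    using com by (simp only: left_lie_comodule_def)
  ultimately show ?thesis
    using clinear_0[OF clinear_tensor_lift[OF bilh]] by (simp only: eval_iter.simps) metis
qed

text \<open>After stripping \<open>j\<close> letters, the pair leads the word and the comodule
  condition applies to the remaining vector.\<close>

lemma eval_iter_alternating:
  fixes Q :: "'g::complex_lie_algebra list \<Rightarrow> 'w::complex_vector"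
  assumes com: "left_lie_comodule nab"
  shows "multilinear n Q \<Longrightarrow> Suc j < n
    \<Longrightarrow> (\<And>u x w. length u = j \<Longrightarrow> Suc (Suc (j + length w)) = n \<Longrightarrow> Q (u @ x # x # w) = 0)
    \<Longrightarrow> eval_iter nab n Q v = 0"
proof (induction j arbitrary: n Q v)
  case 0
  then obtain k where "n = Suc (Suc k)" by (auto simp: less_iff_Suc_add)
  then show ?case using eval_iter_alternating_head[OF com, of k Q v] 0(1) 0(3)[of "[]"] by simp
next
  case (Suc j)
  then obtain k where n: "n = Suc k" by (cases n) auto
  have "eval_iter nab k (\<lambda>l. Q (X # l)) w = 0" for X w
  proof (rule Suc.IH)
    show "multilinear k (\<lambda>l. Q (X # l))" using Suc.prems(1) n by (simp add: multilinear_Cons)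
    show "Suc j < k" using Suc.prems(2) n by simp
    show "Q (X # u @ x # x # w) = 0" if "length u = j" "Suc (Suc (j + length w)) = k" for u x w
      using Suc.prems(3)[of "X # u" w x] that n by simp
  qed
  then have "eval_iter nab k (\<lambda>l. Q (X # l)) = (\<lambda>w. 0)" for X by (rule ext)
  then show ?case by (simp add: n tensor_lift_zero)
qed

lemma eq_neg_self_iff: "x = - x \<longleftrightarrow> x = (0 :: 'a::complex_vector)"
proof
  assume "x = - x"
  then have "2 *\<^sub>C x = 0"
    using scaleC_add_left[of 1 1 x] by (simp add: scaleC_one eq_neg_iff_add_eq_0)
  then show "x = 0" by simp
qed simp

lemma eval_iter_antisymmetric:
  fixes Q :: "'g::complex_lie_algebra list \<Rightarrow> 'w::complex_vector"
  assumes com: "left_lie_comodule nab" and Q: "multilinear n Q" and j: "Suc j < n"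
    and anti: "\<And>w. length w = n \<Longrightarrow> Q (swap_at j w) = - Q w"
  shows "eval_iter nab n Q v = 0"
proof (rule eval_iter_alternating[OF com Q j])
  fix u w :: "'g list" and x assume "length u = j" "Suc (Suc (j + length w)) = n"
  then have "Q (u @ x # x # w) = - Q (u @ x # x # w)"
    using anti[of "u @ x # x # w"] by (simp add: swap_at_append)
  then show "Q (u @ x # x # w) = 0" by (simp only: eq_neg_self_iff)
qed

text \<open>The difference of \<open>Q\<close> and its exchanged version is antisymmetric in the
  pair, so its evaluation vanishes.\<close>

lemma eval_iter_swap:
  fixes Q :: "'g::complex_lie_algebra list \<Rightarrow> 'w::complex_vector"
  assumes com: "left_lie_comodule nab" and Q: "multilinear n Q" and j: "Suc j < n"
  shows "eval_iter nab n (\<lambda>w. Q (swap_at j w)) v = eval_iter nab n Q v"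
proof -
  have "eval_iter nab n (\<lambda>w. Q w + (- 1) *\<^sub>C Q (swap_at j w)) v = 0"
  proof (rule eval_iter_antisymmetric[OF com _ j])
    show "multilinear n (\<lambda>w. Q w + (- 1) *\<^sub>C Q (swap_at j w))"
      by (intro multilinear_add multilinear_scale multilinear_swap Q j)
    fix w :: "'g list" assume "length w = n"
    then obtain u x y v where "w = u @ x # y # v" "length u = j"
      using j list_split_at2 by metis
    then show "Q (swap_at j w) + (- 1) *\<^sub>C Q (swap_at j (swap_at j w))
        = - (Q w + (- 1) *\<^sub>C Q (swap_at j w))"
      by (simp add: swap_at_append scaleC_one)
  qed
  then show ?thesis by (simp only: eval_iter_add eval_iter_scale) (simp add: scaleC_one)
qed

text \<open>The contraction cocycle is antisymmetric in the contracted pair, so it evaluates to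
  zero, and evaluation does not see exchanges. Multilinearity is carried along because
  \<open>eval_iter_swap\<close> requires it.\<close>

lemma eval_iter_eul:
  fixes nab :: "'v::complex_vector \<Rightarrow> ('g::complex_lie_algebra, 'v) tensor"
  assumes com: "left_lie_comodule nab"
  shows "eval_iter nab (Suc (Suc n)) (eul (Suc (Suc n))) v = 0"
proof -
  let ?n = "Suc (Suc n)" and ?b = "\<lambda>j (w :: 'g list). eul (Suc n) (contract_at j w)"
  interpret adjacent_cocycle ?n "{w :: 'g list. length w = ?n}" swap_at ?b
    by (rule adjacent_cocycle_eul)
  have "multilinear ?n (primitive swap_at ?b ?n ?n)
      \<and> (\<forall>v. eval_iter nab ?n (primitive swap_at ?b ?n ?n) v = 0)"
    using order_refl[of ?n]
  proof (induction rule: primitive_closure)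
    case (swap Q j)
    then show ?case using eval_iter_swap[OF com] multilinear_swap by metis
  next
    case (cocycle j)
    have "multilinear ?n (?b j)"
      using cocycle eul_multilinear_equivariant[where 'g = 'g] by (intro multilinear_contract) auto
    then show ?case
      using eval_iter_antisymmetric[OF com _ cocycle] cocycle_involutive cocycle by blast
  next
    case zero
    then show ?case using multilinear_zero eval_iter_zero by blast
  next
    case (add Q R)
    then show ?case by (simp only: multilinear_add eval_iter_add) simp
  next
    case (scale Q c)
    then show ?case by (simp only: multilinear_scale eval_iter_scale) simp
  qed
  then show ?thesis by (simp only: eul.simps)
qed


section \<open>Reduction of the condition over the enveloping algebra to generators\<close>

lemma tensor_map_fun_add_right: "tensor_map f (\<lambda>b. g b + g' b) t = tensor_map f g t + tensor_map f g' t"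
  by (simp add: tensor_map_def tensor_add_right tensor_lift_fun_add)

lemma tensor_map_fun_scale_right: "tensor_map f (\<lambda>b. c *\<^sub>C g b) t = c *\<^sub>C tensor_map f g t"
  by (simp add: tensor_map_def tensor_scale_right tensor_lift_fun_scale)

lemma tensor3_induct [case_names tensor add]:
  assumes tensor: "\<And>a b c. P (a \<otimes> (b \<otimes> c))" and add: "\<And>s t. P s \<Longrightarrow> P t \<Longrightarrow> P (s + t)"
  shows "P t"
proof (induction t rule: tensor_induct)
  case (tensor a s)
  show ?case
    by (induction s rule: tensor_induct) (simp_all add: assms tensor_add_right)
qed (rule add)

lemma clinear_mult_left: "clinear (\<lambda>b. a * b :: 'a::complex_algebra_1)"
  by (simp add: clinear_iff distrib_left scaleC_mult_right)

lemma clinear_mult_right: "clinear (\<lambda>b. b * a :: 'a::complex_algebra_1)"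
  by (simp add: clinear_iff distrib_right scaleC_mult_left)

definition uea_comult2 :: "'g::complex_lie_algebra uea \<Rightarrow> ('g uea, ('g uea, 'g uea) tensor) tensor" where
  "uea_comult2 h = tensor_map id uea_comult (uea_comult h)"

lemma clinear_uea_comult2: "clinear uea_comult2"
  unfolding uea_comult2_def
  by (rule clinear_compose[OF clinear_uea_comult clinear_tensor_map[OF clinear_id clinear_uea_comult]])

lemma uea_comult2_one: "uea_comult2 1 = 1 \<otimes> (1 \<otimes> 1)"
  unfolding uea_comult2_def uea_comult_one tensor_map_tensor[OF clinear_id clinear_uea_comult]
  by simp

lemma uea_comult2_gen:
  "uea_comult2 (uea_gen X)
    = uea_gen X \<otimes> (1 \<otimes> 1) + 1 \<otimes> (uea_gen X \<otimes> 1) + 1 \<otimes> (1 \<otimes> uea_gen X)"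
  unfolding uea_comult2_def uea_comult_gen
    clinear_add[OF clinear_tensor_map[OF clinear_id clinear_uea_comult]]
    tensor_map_tensor[OF clinear_id clinear_uea_comult] uea_comult_one
  by (simp add: tensor_add_right add.assoc)

lemma uea_comult2_mult: "uea_comult2 (a * b) = uea_comult2 a * uea_comult2 b"
proof -
  note lin = clinear_add[OF clinear_tensor_map[OF clinear_id clinear_uea_comult]]
  have "tensor_map id uea_comult (s * t) = tensor_map id uea_comult s * tensor_map id uea_comult t"
    for s t :: "('a uea, 'a uea) tensor"
  proof (induction s rule: tensor_induct)
    case s: (tensor a b)
    show ?case
    proof (induction t rule: tensor_induct)
      case (tensor c d)
      show ?case
        by (simp only: tensor_times_tensor tensor_map_tensor[OF clinear_id clinear_uea_comult]
            uea_comult_mult, simp only: id_apply)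
    qed (simp only: distrib_left lin)
  qed (simp only: distrib_right lin)
  then show ?thesis by (simp only: uea_comult2_def uea_comult_mult)
qed

context
  fixes act :: "'v::complex_vector \<Rightarrow> 'g::complex_lie_algebra \<Rightarrow> 'v"
  assumes act: "right_lie_module act"
begin

definition twist :: "'g uea \<Rightarrow> 'g uea \<Rightarrow> 'g uea \<Rightarrow> ('g uea, 'v) tensor \<Rightarrow> ('g uea, 'v) tensor" where
  "twist h1 h2 h3 = tensor_map (\<lambda>u. uea_antipode h3 * u * h1) (\<lambda>w. uea_act act w h2)"

definition twisted_act ::
    "('g uea, 'v) tensor \<Rightarrow> ('g uea, ('g uea, 'g uea) tensor) tensor \<Rightarrow> ('g uea, 'v) tensor" where
  "twisted_act t = tensor_lift (\<lambda>h1. tensor_lift (\<lambda>h2 h3. twist h1 h2 h3 t))"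

lemma clinear_uea_act: "clinear (\<lambda>w. uea_act act w h)"
  using cbilinear_uea_act[OF act] by (simp add: cbilinear_def)

lemma clinear_sandwich: "clinear (\<lambda>u. a * u * b :: 'g uea)"
  by (rule clinear_compose[OF clinear_mult_left clinear_mult_right])

lemma clinear_twist: "clinear (twist h1 h2 h3)"
  unfolding twist_def by (rule clinear_tensor_map[OF clinear_sandwich clinear_uea_act])

text \<open>The antipode reverses products, so successive left factors combine as
  \<open>uea_antipode (h3 * k3)\<close>. Hence the twist is a right action in all three
  arguments.\<close>

lemma twist_twist: "twist k1 k2 k3 (twist h1 h2 h3 t) = twist (h1 * k1) (h2 * k2) (h3 * k3) t"
  unfolding twist_def
  by (simp only: tensor_map_compose[OF clinear_sandwich clinear_uea_act clinear_sandwich clinear_uea_act],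
      simp add: uea_antipode_mult uea_act_mult[OF act] mult.assoc)

lemma cbilinear_twist: "cbilinear (\<lambda>h2 h3. twist h1 h2 h3 t)"
  using cbilinear_uea_act[OF act] unfolding twist_def
  by (intro cbilinearI)
    (simp_all add: cbilinear_iff clinear_add[OF clinear_uea_antipode] clinear_scale[OF clinear_uea_antipode]
      distrib_right scaleC_mult_left tensor_map_fun_add_left tensor_map_fun_scale_left
      tensor_map_fun_add_right tensor_map_fun_scale_right)

lemma cbilinear_twist_lift: "cbilinear (\<lambda>h1. tensor_lift (\<lambda>h2 h3. twist h1 h2 h3 t))"
proof (rule cbilinearI)
  have "twist (h + h') h2 h3 t = twist h h2 h3 t + twist h' h2 h3 t" for h h' h2 h3
    unfolding twist_def distrib_left by (rule tensor_map_fun_add_left)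
  then show "tensor_lift (\<lambda>h2 h3. twist (h + h') h2 h3 t) s
      = tensor_lift (\<lambda>h2 h3. twist h h2 h3 t) s + tensor_lift (\<lambda>h2 h3. twist h' h2 h3 t) s" for h h' s
    by (simp add: tensor_lift_fun_add)
  have "twist (c *\<^sub>C h) h2 h3 t = c *\<^sub>C twist h h2 h3 t" for c h h2 h3
    unfolding twist_def scaleC_mult_right by (rule tensor_map_fun_scale_left)
  then show "tensor_lift (\<lambda>h2 h3. twist (c *\<^sub>C h) h2 h3 t) s
      = c *\<^sub>C tensor_lift (\<lambda>h2 h3. twist h h2 h3 t) s" for c h s
    by (simp add: tensor_lift_fun_scale)
qed (rule clinear_add[OF clinear_tensor_lift[OF cbilinear_twist]]
    clinear_scale[OF clinear_tensor_lift[OF cbilinear_twist]])+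

lemma clinear_twisted_act: "clinear (twisted_act t)"
  unfolding twisted_act_def by (rule clinear_tensor_lift[OF cbilinear_twist_lift])

lemma twisted_act_tensor: "twisted_act t (h1 \<otimes> (h2 \<otimes> h3)) = twist h1 h2 h3 t"
  unfolding twisted_act_def
  by (simp only: tensor_lift_tensor[OF cbilinear_twist_lift] tensor_lift_tensor[OF cbilinear_twist])

lemma twisted_act_add_left: "twisted_act (s + t) x = twisted_act s x + twisted_act t x"
  by (induction x rule: tensor3_induct)
    (simp_all add: twisted_act_tensor clinear_add[OF clinear_twist] clinear_add[OF clinear_twisted_act])

lemma twisted_act_mult: "twisted_act t (x * y) = twisted_act (twisted_act t x) y"
proof (induction x rule: tensor3_induct)
  case x: (tensor a b c)
  show ?case
    by (induction y rule: tensor3_induct)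
      (simp_all add: tensor_times_tensor twisted_act_tensor twist_twist distrib_left
        clinear_add[OF clinear_twisted_act])
qed (simp add: distrib_right clinear_add[OF clinear_twisted_act] twisted_act_add_left)

lemma twisted_act_one: "twisted_act t (uea_comult2 1) = t"
  by (simp add: uea_comult2_one twisted_act_tensor twist_def uea_antipode_one uea_act_one[OF act]
      tensor_map_id)

text \<open>The iterated coproduct of a generator has three terms. The outer ones give right
  multiplication and, through the antipode, minus left multiplication; the middle one gives the
  action on the vector.\<close>

lemma twisted_act_gen:
  "twisted_act t (uea_comult2 (uea_gen X))
    = tensor_map id (\<lambda>w. act w X) t + tensor_map (\<lambda>u. u * uea_gen X - uea_gen X * u) id t"
proof -
  have "tensor_map (\<lambda>u. u * uea_gen X - uea_gen X * u) id t
      = tensor_map (\<lambda>u. u * uea_gen X) id t + tensor_map (\<lambda>u. - uea_gen X * u) id t"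
    by (simp add: tensor_map_fun_add_left[symmetric])
  then show ?thesis
    by (simp add: uea_comult2_gen clinear_add[OF clinear_twisted_act] twisted_act_tensor twist_def
        uea_antipode_one uea_antipode_gen uea_act_one[OF act] uea_act_gen[OF act] id_def algebra_simps)
qed

lemma AYD_uea_iff_gen:
  assumes unab: "clinear unab"
  shows "AYD_uea (uea_act act) unab \<longleftrightarrow> (\<forall>v X. unab (act v X)
    = tensor_map id (\<lambda>w. act w X) (unab v) + tensor_map (\<lambda>u. u * uea_gen X - uea_gen X * u) id (unab v))"
    (is "_ \<longleftrightarrow> ?gen")
proof -
  have iff: "AYD_uea (uea_act act) unab
      \<longleftrightarrow> (\<forall>v h. unab (uea_act act v h) = twisted_act (unab v) (uea_comult2 h))"
    by (simp only: AYD_uea_def twisted_act_def twist_def uea_comult2_def)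
  show ?thesis
  proof
    assume "AYD_uea (uea_act act) unab"
    then have "unab (uea_act act v (uea_gen X)) = twisted_act (unab v) (uea_comult2 (uea_gen X))" for v X
      by (simp only: iff)
    then show ?gen by (simp only: uea_act_gen[OF act] twisted_act_gen) simp
  next
    assume gen: ?gen
    \<comment> \<open>\<open>v\<close> is generalised: the first letter acts on \<open>v\<close>,
      and the rest of the word is treated at \<open>act v X\<close>.\<close>
    have unab_word: "unab (uea_act act v (prod_list (map uea_gen ws)))
        = twisted_act (unab v) (uea_comult2 (prod_list (map uea_gen ws)))" for v ws
    proof (induction ws arbitrary: v)
      case Nil
      show ?case by (simp add: uea_act_one[OF act] twisted_act_one)
    next
      case (Cons X ws)
      have "unab (act v X) = twisted_act (unab v) (uea_comult2 (uea_gen X))"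
        using gen by (simp only: twisted_act_gen)
      then show ?case
        using Cons by (simp add: uea_act_mult[OF act] uea_act_gen[OF act] uea_comult2_mult twisted_act_mult)
    qed
    have "unab (uea_act act v h) = twisted_act (unab v) (uea_comult2 h)" for v h
    proof (induction h rule: uea_induct)
      case (word c ws)
      have "uea_act act v (c *\<^sub>C h) = c *\<^sub>C uea_act act v h" for h
        using cbilinear_uea_act[OF act] by (simp add: cbilinear_iff)
      then show ?case
        by (simp add: unab_word clinear_scale[OF unab] clinear_scale[OF clinear_uea_comult2]
            clinear_scale[OF clinear_twisted_act])
    next
      case (add s t)
      have "uea_act act v (s + t) = uea_act act v s + uea_act act v t"
        using cbilinear_uea_act[OF act] by (simp add: cbilinear_iff)
      then show ?case
        by (simp add: add clinear_add[OF unab] clinear_add[OF clinear_uea_comult2]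
            clinear_add[OF clinear_twisted_act])
    qed
    then show "AYD_uea (uea_act act) unab" by (simp add: iff)
  qed
qed

end


section \<open>The enveloping algebra coaction\<close>

lemma multilinear_uea_word: "multilinear k (\<lambda>l. prod_list (map uea_gen l))"
  by (simp add: multilinear_def clinear_iff distrib_left distrib_right scaleC_mult_left
      scaleC_mult_right clinear_add[OF clinear_uea_gen] clinear_scale[OF clinear_uea_gen])

lemma clinear_commutator: "clinear (\<lambda>u. u * a - a * u :: 'a::complex_algebra_1)"
  by (intro complex_vector_pair.linear_compose_sub clinear_mult_left clinear_mult_right)

text \<open>By the defining relation of U(g), bracketing a letter with \<open>X\<close> is a
  commutator, and the commutators telescope along the product.\<close>

lemma der_uea_word:
  "der X (\<lambda>l. prod_list (map uea_gen l)) w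
    = prod_list (map uea_gen w) * uea_gen X - uea_gen X * prod_list (map uea_gen w)"
proof (induction w)
  case (Cons x w)
  have "der X (\<lambda>l. uea_gen x * prod_list (map uea_gen l)) w
      = uea_gen x * der X (\<lambda>l. prod_list (map uea_gen l)) w"
    by (rule der_compose[OF clinear_mult_left])
  then show ?case by (simp add: Cons uea_gen_bracket[symmetric] algebra_simps)
qed simp

context
  fixes nab :: "'v::complex_vector \<Rightarrow> ('g::complex_lie_algebra, 'v) tensor"
  assumes nab: "clinear nab" and conil: "locally_conilpotent nab"
begin

text \<open>The series may be cut at any bound past the vanishing iterate, so several vectors can
  share one bound. The strict \<open>n < m\<close> keeps the index 0, which contributes
  \<open>1 \<otimes> v\<close>.\<close>

lemma uea_coact_eq_sum:
  assumes n: "coact_iter nab n v = 0" and m: "n < m"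
  shows "uea_coact nab v
    = (\<Sum>k<m. (1 / fact k) *\<^sub>C eval_iter nab k (\<lambda>l. prod_list (map uea_gen l)) v)"
proof -
  define f where "f k = (1 / fact k) *\<^sub>C tensor_map uea_proj id (coact_iter nab k v)" for k
  have f: "f k = (1 / fact k) *\<^sub>C eval_iter nab k (\<lambda>l. prod_list (map uea_gen l)) v" for k
    by (simp only: f_def tensor_map_coact_iter[OF nab clinear_uea_proj] uea_proj_word)
  have zero: "f k = 0" if "coact_iter nab k v = 0" for k
    by (simp add: f_def that clinear_0[OF clinear_tensor_map[OF clinear_uea_proj clinear_id]])
  have "(\<Sum>k | k \<ge> 1 \<and> coact_iter nab k v \<noteq> 0. f k) = sum f {1..<m}"
  proof (rule sum.mono_neutral_left)
    show "{k. k \<ge> 1 \<and> coact_iter nab k v \<noteq> 0} \<subseteq> {1..<m}"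
    proof
      fix k assume k: "k \<in> {k. k \<ge> 1 \<and> coact_iter nab k v \<noteq> 0}"
      then have "\<not> n \<le> k" using coact_iter_eq_0_mono[OF nab n] by blast
      with k m show "k \<in> {1..<m}" by simp
    qed
  qed (auto simp: zero)
  moreover have "f 0 = 1 \<otimes> v" by (simp add: f scaleC_one)
  moreover have "{..<m} = insert 0 {1..<m}" using m by auto
  ultimately have "uea_coact nab v = sum f {..<m}"
    unfolding uea_coact_def f_def[symmetric] by simp
  also have "\<dots> = (\<Sum>k<m. (1 / fact k) *\<^sub>C eval_iter nab k (\<lambda>l. prod_list (map uea_gen l)) v)"
    by (rule sum.cong[OF refl f])
  finally show ?thesis .
qed

lemma clinear_uea_coact: "clinear (uea_coact nab)"
proof (rule clinearI)
  note lin = clinear_eval_iter[OF nab multilinear_uea_word]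
  note lin' = clinear_coact_iter[OF nab]
  fix x y c
  obtain n1 n2 where n: "coact_iter nab n1 x = 0" "coact_iter nab n2 y = 0"
    using conil by (meson locally_conilpotent_def)
  \<comment> \<open>A common bound for \<open>x\<close> and \<open>y\<close> also serves their sum
    and multiples, so the truncated series can be compared termwise.\<close>
  define n where "n = max n1 n2"
  have x: "coact_iter nab n x = 0" and y: "coact_iter nab n y = 0"
    using coact_iter_eq_0_mono[OF nab n(1), of n] coact_iter_eq_0_mono[OF nab n(2), of n]
    by (simp_all add: n_def)
  have xy: "coact_iter nab n (x + y) = 0" and cx: "coact_iter nab n (c *\<^sub>C x) = 0"
    by (simp_all add: clinear_add[OF lin'] clinear_scale[OF lin'] x y)
  show "uea_coact nab (x + y) = uea_coact nab x + uea_coact nab y"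
    by (simp only: uea_coact_eq_sum[OF x lessI] uea_coact_eq_sum[OF y lessI]
        uea_coact_eq_sum[OF xy lessI] clinear_add[OF lin] scaleC_add_right sum.distrib)
  show "uea_coact nab (c *\<^sub>C x) = c *\<^sub>C uea_coact nab x"
    by (simp only: uea_coact_eq_sum[OF x lessI] uea_coact_eq_sum[OF cx lessI] clinear_scale[OF lin]
        complex_vector.scale_sum_right scaleC_scaleC mult.commute)
qed

lemma tensor_map_uea_coact:
  assumes n: "coact_iter nab n v = 0" and m: "n < m" and L: "clinear L"
  shows "tensor_map L id (uea_coact nab v)
    = (\<Sum>k<m. (1 / fact k) *\<^sub>C eval_iter nab k (\<lambda>l. L (prod_list (map uea_gen l))) v)"
  by (simp only: uea_coact_eq_sum[OF n m] clinear_sum[OF clinear_tensor_map[OF L clinear_id]]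
      clinear_scale[OF clinear_tensor_map[OF L clinear_id]]
      eval_iter_compose[OF nab L multilinear_uea_word])

lemma uea_coact_act:
  assumes act: "cbilinear act" and ayd: "AYD_lie act nab"
  shows "uea_coact nab (act v X) = tensor_map id (\<lambda>w. act w X) (uea_coact nab v)
    + tensor_map (\<lambda>u. u * uea_gen X - uea_gen X * u) id (uea_coact nab v)"
proof -
  obtain n1 n2 where n: "coact_iter nab n1 v = 0" "coact_iter nab n2 (act v X) = 0"
    using conil by (meson locally_conilpotent_def)
  define m where "m = Suc (max n1 n2)"
  have m: "n1 < m" "n2 < m" by (simp_all add: m_def less_Suc_eq_le)
  have actX: "clinear (\<lambda>w. act w X)" using act by (simp add: cbilinear_def)
  note lin = clinear_tensor_map[OF clinear_id actX]
  have der: "der X (\<lambda>l. prod_list (map uea_gen l))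
      = (\<lambda>w. prod_list (map uea_gen w) * uea_gen X - uea_gen X * prod_list (map uea_gen w))"
    by (rule ext) (rule der_uea_word)
  show ?thesis
    by (subst tensor_map_uea_coact[OF n(1) m(1) clinear_commutator], simp only: uea_coact_eq_sum[OF n(1) m(1)]
        uea_coact_eq_sum[OF n(2) m(2)] eval_iter_act[OF nab act ayd multilinear_uea_word]
        clinear_sum[OF lin] clinear_scale[OF lin] der scaleC_add_right sum.distrib)
qed

end

section \<open>Recovering the Lie coaction by the projection \<pi>\<close>

definition uea_lie_proj :: "'g::complex_lie_algebra uea \<Rightarrow> 'g" where
  "uea_lie_proj = uea_ext word_proj"

lemma clinear_uea_lie_proj: "clinear uea_lie_proj"
  unfolding uea_lie_proj_def by (rule clinear_uea_ext[OF word_proj_compatible])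

lemma uea_lie_proj_word: "uea_lie_proj (prod_list (map uea_gen w)) = word_proj w"
  unfolding uea_lie_proj_def by (rule uea_ext_word[OF word_proj_compatible])

text \<open>Equivariance of \<pi>: on U(g) the adjoint derivation is the commutator, and
  \<open>word_proj\<close> intertwines it with the bracket.\<close>

lemma uea_lie_proj_commutator_word:
  "uea_lie_proj (prod_list (map uea_gen w) * uea_gen X - uea_gen X * prod_list (map uea_gen w))
    = lie_bracket (word_proj w) X"
proof -
  have "uea_lie_proj (der X (\<lambda>l. prod_list (map uea_gen l)) w)
      = der X (\<lambda>l. uea_lie_proj (prod_list (map uea_gen l))) w"
    by (rule der_compose[OF clinear_uea_lie_proj, symmetric])
  then show ?thesis by (simp only: der_uea_word uea_lie_proj_word der_word_proj)
qed

context
  fixes nab :: "'v::complex_vector \<Rightarrow> ('g::complex_lie_algebra, 'v) tensor"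
  assumes com: "left_lie_comodule nab" and conil: "locally_conilpotent nab"
begin

text \<open>Only degree one survives: \<pi> vanishes on 1, and higher degrees are killed by
  \<open>eval_iter_eul\<close>. The bound \<open>Suc (Suc m)\<close> ensures that index 1 is in
  range.\<close>

lemma sum_eval_iter_word_proj:
  "(\<Sum>k<Suc (Suc m). (1 / fact k) *\<^sub>C eval_iter nab k word_proj v) = nab v"
proof -
  have "(0 :: 'g) \<otimes> v = 0" using tensor_scale_left[of 0 "0 :: 'g" v] by simp
  then have 0: "eval_iter nab 0 word_proj v = 0" by (simp add: word_proj_def)
  have 1: "eval_iter nab (Suc 0) word_proj v = nab v"
    using tensor_map_id[of "nab v"] by (simp add: word_proj_def tensor_map_def)
  have "eval_iter nab (Suc (Suc k)) word_proj v = 0" for k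
    using eval_iter_cong[of "Suc (Suc k)" word_proj "eul (Suc (Suc k))" nab v] eval_iter_eul[OF com, of k v]
    by (simp only: word_proj_def)
  then show ?thesis
    by (simp only: sum.lessThan_Suc_shift) (simp only: 0 1, simp add: scaleC_one)
qed

lemma nab_eq_proj_uea_coact: "tensor_map uea_lie_proj id (uea_coact nab v) = nab v"
  and commutator_proj_uea_coact:
    "tensor_map (\<lambda>u. uea_lie_proj (u * uea_gen X - uea_gen X * u)) id (uea_coact nab v)
      = tensor_map (\<lambda>Y. lie_bracket Y X) id (nab v)"
proof -
  have nab: "clinear nab" using com by (simp add: left_lie_comodule_def)
  obtain n where n: "coact_iter nab n v = 0" using conil by (meson locally_conilpotent_def)
  have m: "n < Suc (Suc n)" by simp
  show "tensor_map uea_lie_proj id (uea_coact nab v) = nab v"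
    by (simp only: tensor_map_uea_coact[OF nab conil n m clinear_uea_lie_proj] uea_lie_proj_word
        sum_eval_iter_word_proj)
  note lin = clinear_tensor_map[OF clinear_lie_bracket_left clinear_id]
  have "tensor_map (\<lambda>u. uea_lie_proj (u * uea_gen X - uea_gen X * u)) id (uea_coact nab v)
      = tensor_map (\<lambda>Y. lie_bracket Y X) id
          (\<Sum>k<Suc (Suc n). (1 / fact k) *\<^sub>C eval_iter nab k word_proj v)"
    by (simp only: tensor_map_uea_coact[OF nab conil n m
          clinear_compose[OF clinear_commutator clinear_uea_lie_proj]] uea_lie_proj_commutator_word
        eval_iter_compose[OF nab clinear_lie_bracket_left multilinear_word_proj]
        clinear_sum[OF lin] clinear_scale[OF lin])
  then show "tensor_map (\<lambda>u. uea_lie_proj (u * uea_gen X - uea_gen X * u)) id (uea_coact nab v)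
      = tensor_map (\<lambda>Y. lie_bracket Y X) id (nab v)"
    by (simp only: sum_eval_iter_word_proj)
qed

end

theorem proposition5p10:
  fixes act :: "'v::complex_vector \<Rightarrow> 'g::complex_lie_algebra \<Rightarrow> 'v"
    and nab :: "'v \<Rightarrow> ('g, 'v) tensor"
  assumes "finite_dim TYPE('g)"
    and "right_lie_module act"
    and "left_lie_comodule nab"
    and "locally_conilpotent nab"
  shows "AYD_lie act nab \<longleftrightarrow> AYD_uea (uea_act act) (uea_coact nab)"
proof -
  have nab: "clinear nab" using assms(3) by (simp add: left_lie_comodule_def)
  have act: "cbilinear act" using assms(2) by (simp add: right_lie_module_def)
  then have actX: "clinear (\<lambda>w. act w X)" for X by (simp add: cbilinear_def)
  note pi = clinear_uea_lie_proj
  show ?thesis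
    unfolding AYD_uea_iff_gen[OF assms(2) clinear_uea_coact[OF nab assms(4)]]
  proof (intro iffI allI)
    fix v X assume "AYD_lie act nab"
    then show "uea_coact nab (act v X) = tensor_map id (\<lambda>w. act w X) (uea_coact nab v)
        + tensor_map (\<lambda>u. u * uea_gen X - uea_gen X * u) id (uea_coact nab v)"
      by (rule uea_coact_act[OF nab assms(4) act])
  next
    assume gen: "\<forall>v X. uea_coact nab (act v X) = tensor_map id (\<lambda>w. act w X) (uea_coact nab v)
        + tensor_map (\<lambda>u. u * uea_gen X - uea_gen X * u) id (uea_coact nab v)"
    have proj_act: "tensor_map uea_lie_proj id (tensor_map id (\<lambda>w. act w X) t)
        = tensor_map id (\<lambda>w. act w X) (tensor_map uea_lie_proj id t)" for X t
      by (simp only: tensor_map_compose[OF clinear_id actX pi clinear_id]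
          tensor_map_compose[OF pi clinear_id clinear_id actX] id_apply)
    have proj_commutator: "tensor_map uea_lie_proj id (tensor_map (\<lambda>u. u * uea_gen X - uea_gen X * u) id t)
        = tensor_map (\<lambda>u. uea_lie_proj (u * uea_gen X - uea_gen X * u)) id t" for X t
      by (simp only: tensor_map_compose[OF clinear_commutator clinear_id pi clinear_id], simp only: id_def)
    note proj = nab_eq_proj_uea_coact[OF assms(3,4)]
    show "AYD_lie act nab"
      unfolding AYD_lie_def
    proof (intro allI)
      fix v X
      \<comment> \<open>Apply \<pi> to the first tensor factor of the generator condition: it
        commutes with the action on the second factor and turns the commutator into the Lie
        bracket.\<close>
      have "nab (act v X) = tensor_map uea_lie_proj id (uea_coact nab (act v X))"
        by (simp only: proj)
      also have "\<dots> = tensor_map id (\<lambda>w. act w X) (nab v) + tensor_map (\<lambda>Y. lie_bracket Y X) id (nab v)"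
        by (simp only: gen[rule_format] clinear_add[OF clinear_tensor_map[OF pi clinear_id]] proj_act
            proj_commutator proj commutator_proj_uea_coact[OF assms(3,4)])
      finally show "nab (act v X)
        = tensor_map id (\<lambda>w. act w X) (nab v) + tensor_map (\<lambda>Y. lie_bracket Y X) id (nab v)" .
    qed
  qed
qed

end
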